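(* Let $\mu\ge0$ and let $H(t)$, $t\in\mathbb R$, be a $1$-periodic family of symmetric operators on $\mathcal H$ such that for every $r\ge0$ the operators $H(t):\mathcal H^{r+\mu}\to\mathcal H^r$ are bounded and depend continuously on $t\in[0,1]$ in the operator norm of $\mathcal L(\mathcal H^{r+\mu},\mathcal H^r)$. Let $L\ge0$ be an integer, $r\ge0$, and $u\in\mathcal H^{r+(L+1)\mu}$. Then, for every fixed $T>0$, $$H^{(T)}_{\mathrm{FM},L,N}P_Nu\longrightarrow H^{(T)}_{\mathrm{FM},L}u\qquad\text{in }\mathcal H^r\text{ as }N\to\infty .$$
   Context: $\mathcal H$ is a complex separable Hilbert space and $H_0$ a positive self-adjoint operator on $\mathcal H$ with compact resolvent (spectrum contained in $[0,\infty)$). For $N>0$, $P_N=\mathbf 1_{[0,N]}(H_0)$, $\mathcal H_N=P_N\mathcal H$ (finite-dimensional), $H_N(t)=P_NH(t)P_N$ on $\mathcal H_N$. For $r\ge0$, $\mathcal H^r=D((1+H_0)^r)$ with norm $\|u\|_r=\|(1+H_0)^ru\|$. Floquet--Magnus coefficients: for a family $A(\tau)$, $\tau\in[0,1]$, put $$D_n[A]=\int_{1\ge\tau_1\ge\dots\ge\tau_n\ge0}A(\tau_1)A(\tau_2)\cdots A(\tau_n)\,d\tau_n\cdots d\tau_1,$$ $$\mathrm{FM}^{[\ell]}[A]=\mathrm i\,(-\mathrm i)^{\ell+1}\sum_{k=1}^{\ell+1}\frac{(-1)^{k-1}}{k}\sum_{\substack{n_1+\dots+n_k=\ell+1\\ n_i\ge1}}D_{n_1}[A]\cdots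 D_{n_k}[A].$$ This is the coefficient in the Magnus expansion $\log U^{(T)}(T,0)\sim-\mathrm iT\sum_{\ell\ge0}T^\ell\,\mathrm{FM}^{[\ell]}[A]$ for $\mathrm i\partial_tU^{(T)}=A(t/T)U^{(T)}$; it is equal to a universal linear combination of iterated integrals of nested commutators of $\ell+1$ factors $A(\tau_i)$. Then $H^{[\ell]}_{\mathrm{FM},N}:=\mathrm{FM}^{[\ell]}[H_N]$ is an operator on $\mathcal H_N$, and $H^{[\ell]}_{\mathrm{FM}}:=\mathrm{FM}^{[\ell]}[H]$ is a bounded operator $\mathcal H^{r+(\ell+1)\mu}\to\mathcal H^r$ for every $r\ge0$. The effective Hamiltonians of order $L$ are $$H^{(T)}_{\mathrm{FM},L,N}=\sum_{\ell=0}^LT^\ell H^{[\ell]}_{\mathrm{FM},N},\qquad H^{(T)}_{\mathrm{FM},L}=\sum_{\ell=0}^LT^\ell H^{[\ell]}_{\mathrm{FM}} .$$ *)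

theory Defs
  imports "HOL-Analysis.Analysis"
begin

section \<open>Complex Hilbert spaces\<close>

text \<open>
  The inner product is antilinear in its first argument.  A complex Hilbert space carries a
  canonical real inner product, the real part of the complex one; taking \<^class>\<open>real_inner\<close> as
  the superclass supplies the norm \<open>norm x = sqrt (cinner x x)\<close> together with positivity and
  definiteness.
\<close>

class complex_inner = real_inner +
  fixes scaleC :: "complex \<Rightarrow> 'a \<Rightarrow> 'a" (infixr \<open>*\<^sub>C\<close> 75)
    and cinner :: "'a \<Rightarrow> 'a \<Rightarrow> complex"
  assumes scaleC_add_right: "c *\<^sub>C (x + y) = c *\<^sub>C x + c *\<^sub>C y"
    and scaleC_add_left: "(c + d) *\<^sub>C x = c *\<^sub>C x + d *\<^sub>C x"
    and scaleC_scaleC: "c *\<^sub>C (d *\<^sub>C x) = (c * d) *\<^sub>C x"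
    and scaleC_of_real: "complex_of_real a *\<^sub>C x = a *\<^sub>R x"
    and cinner_commute: "cinner x y = cnj (cinner y x)"
    and cinner_add_right: "cinner x (y + z) = cinner x y + cinner x z"
    and cinner_scaleC_right: "cinner x (c *\<^sub>C y) = c * cinner x y"
    and Re_cinner: "Re (cinner x y) = inner x y"

class complex_hilbert = complex_inner + banach


section \<open>Unbounded operators\<close>

text \<open>
  An unbounded operator is given by a domain \<open>D\<close> and a total function \<open>A\<close>, of which only the
  values on \<open>D\<close> are meaningful.
\<close>

definition csubspace :: "'a::complex_inner set \<Rightarrow> bool" where
  "csubspace D \<longleftrightarrow> 0 \<in> D \<and> (\<forall>x\<in>D. \<forall>y\<in>D. x + y \<in> D) \<and> (\<forall>c. \<forall>x\<in>D. c *\<^sub>C x \<in> D)"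

definition clinear_on :: "'a::complex_inner set \<Rightarrow> ('a \<Rightarrow> 'a) \<Rightarrow> bool" where
  "clinear_on D A \<longleftrightarrow> csubspace D \<and>
     (\<forall>x\<in>D. \<forall>y\<in>D. A (x + y) = A x + A y) \<and> (\<forall>c. \<forall>x\<in>D. A (c *\<^sub>C x) = c *\<^sub>C A x)"

definition densely_defined :: "'a::complex_inner set \<Rightarrow> ('a \<Rightarrow> 'a) \<Rightarrow> bool" where
  "densely_defined D A \<longleftrightarrow> clinear_on D A \<and> closure D = UNIV"

definition symmetric_op :: "'a::complex_inner set \<Rightarrow> ('a \<Rightarrow> 'a) \<Rightarrow> bool" where
  "symmetric_op D A \<longleftrightarrow> densely_defined D A \<and> (\<forall>x\<in>D. \<forall>y\<in>D. cinner (A x) y = cinner x (A y))"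

definition op_graph :: "'a set \<Rightarrow> ('a \<Rightarrow> 'a) \<Rightarrow> ('a \<times> 'a) set" where
  "op_graph D A = {(x, A x) | x. x \<in> D}"

definition adjoint_graph :: "'a::complex_inner set \<Rightarrow> ('a \<Rightarrow> 'a) \<Rightarrow> ('a \<times> 'a) set" where
  "adjoint_graph D A = {(y, z). \<forall>x\<in>D. cinner (A x) y = cinner x z}"

definition self_adjoint :: "'a::complex_inner set \<Rightarrow> ('a \<Rightarrow> 'a) \<Rightarrow> bool" where
  "self_adjoint D A \<longleftrightarrow> densely_defined D A \<and> adjoint_graph D A = op_graph D A"

definition resolvent :: "'a::complex_inner set \<Rightarrow> ('a \<Rightarrow> 'a) \<Rightarrow> complex \<Rightarrow> 'a \<Rightarrow> 'a" where
  "resolvent D A z = inv_into D (\<lambda>x. A x - z *\<^sub>C x)"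

definition resolvent_set :: "'a::complex_inner set \<Rightarrow> ('a \<Rightarrow> 'a) \<Rightarrow> complex set" where
  "resolvent_set D A =
     {z. bij_betw (\<lambda>x. A x - z *\<^sub>C x) D UNIV \<and> bounded_linear (resolvent D A z)}"

definition spectrum :: "'a::complex_inner set \<Rightarrow> ('a \<Rightarrow> 'a) \<Rightarrow> complex set" where
  "spectrum D A = - resolvent_set D A"

definition positive_self_adjoint :: "'a::complex_inner set \<Rightarrow> ('a \<Rightarrow> 'a) \<Rightarrow> bool" where
  "positive_self_adjoint D A \<longleftrightarrow>
     self_adjoint D A \<and> spectrum D A \<subseteq> complex_of_real ` {0..}"

definition compact_op :: "('a::complex_inner \<Rightarrow> 'a) \<Rightarrow> bool" where
  "compact_op K \<longleftrightarrow> bounded_linear K \<and> (\<forall>S. bounded S \<longrightarrow> compact (closure (K ` S)))"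

text \<open>By the resolvent identity, one compact resolvent makes all of them compact.\<close>

definition compact_resolvent :: "'a::complex_inner set \<Rightarrow> ('a \<Rightarrow> 'a) \<Rightarrow> bool" where
  "compact_resolvent D A \<longleftrightarrow> (\<exists>z\<in>resolvent_set D A. compact_op (resolvent D A z))"


section \<open>Functional calculus and the associated scale of spaces\<close>

text \<open>
  A self-adjoint operator with compact resolvent has pure point spectrum: its spectral measure is
  the sum of the point masses at its eigenvalues, weighted by the orthogonal projections onto the
  eigenspaces.  The functional calculus \<open>f(A) = \<integral> f dE\<close> is therefore the sum
  over the eigenvalues below, with domain the vectors for which
  \<open>\<integral> \<bar>f\<bar>\<^sup>2 d\<parallel>E x\<parallel>\<^sup>2\<close> is finite.
\<close>

definition orth_proj :: "'a::complex_inner set \<Rightarrow> 'a \<Rightarrow> 'a" where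
  "orth_proj M x = (THE p. p \<in> M \<and> (\<forall>m\<in>M. cinner m (x - p) = 0))"

definition eigenspace :: "'a::complex_inner set \<Rightarrow> ('a \<Rightarrow> 'a) \<Rightarrow> real \<Rightarrow> 'a set" where
  "eigenspace D A l = {x \<in> D. A x = l *\<^sub>R x}"

definition eigenvalues :: "'a::complex_inner set \<Rightarrow> ('a \<Rightarrow> 'a) \<Rightarrow> real set" where
  "eigenvalues D A = {l. \<exists>x\<in>eigenspace D A l. x \<noteq> 0}"

definition fun_calc_dom ::
    "'a::complex_inner set \<Rightarrow> ('a \<Rightarrow> 'a) \<Rightarrow> (real \<Rightarrow> real) \<Rightarrow> 'a set" where
  "fun_calc_dom D A f =
     {x. (\<lambda>l. (f l)\<^sup>2 * (norm (orth_proj (eigenspace D A l) x))\<^sup>2) summable_on eigenvalues D A}"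

definition fun_calc ::
    "'a::complex_inner set \<Rightarrow> ('a \<Rightarrow> 'a) \<Rightarrow> (real \<Rightarrow> real) \<Rightarrow> 'a \<Rightarrow> 'a" where
  "fun_calc D A f x =
     (\<Sum>\<^sub>\<infinity>l\<in>eigenvalues D A. f l *\<^sub>R orth_proj (eigenspace D A l) x)"

definition spec_proj :: "'a::complex_inner set \<Rightarrow> ('a \<Rightarrow> 'a) \<Rightarrow> real \<Rightarrow> 'a \<Rightarrow> 'a" where
  "spec_proj D0 H0 N = fun_calc D0 H0 (indicator {0..N})"

definition Hscale :: "'a::complex_inner set \<Rightarrow> ('a \<Rightarrow> 'a) \<Rightarrow> real \<Rightarrow> 'a set" where
  "Hscale D0 H0 r = fun_calc_dom D0 H0 (\<lambda>l. (1 + l) powr r)"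

definition Hnorm :: "'a::complex_inner set \<Rightarrow> ('a \<Rightarrow> 'a) \<Rightarrow> real \<Rightarrow> 'a \<Rightarrow> real" where
  "Hnorm D0 H0 r x = norm (fun_calc D0 H0 (\<lambda>l. (1 + l) powr r) x)"

definition bounded_between ::
    "'a::complex_inner set \<Rightarrow> ('a \<Rightarrow> 'a) \<Rightarrow> real \<Rightarrow> real \<Rightarrow> ('a \<Rightarrow> 'a) \<Rightarrow> bool" where
  "bounded_between D0 H0 s r A \<longleftrightarrow>
     clinear_on (Hscale D0 H0 s) A \<and>
     (\<forall>x\<in>Hscale D0 H0 s. A x \<in> Hscale D0 H0 r) \<and>
     (\<exists>C. \<forall>x\<in>Hscale D0 H0 s. Hnorm D0 H0 r (A x) \<le> C * Hnorm D0 H0 s x)"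

definition opnorm_between ::
    "'a::complex_inner set \<Rightarrow> ('a \<Rightarrow> 'a) \<Rightarrow> real \<Rightarrow> real \<Rightarrow> ('a \<Rightarrow> 'a) \<Rightarrow> real" where
  "opnorm_between D0 H0 s r A =
     (SUP x\<in>{x \<in> Hscale D0 H0 s. Hnorm D0 H0 s x \<le> 1}. Hnorm D0 H0 r (A x))"


section \<open>Floquet--Magnus coefficients\<close>

text \<open>
  \<open>simplex_integral n b F\<close> is the integral of \<open>F [t1, ..., tn]\<close> over
  \<open>b \<ge> t1 \<ge> ... \<ge> tn \<ge> 0\<close>, with \<open>tn\<close> innermost.
\<close>

primrec simplex_integral :: "nat \<Rightarrow> real \<Rightarrow> (real list \<Rightarrow> 'a::real_normed_vector) \<Rightarrow> 'a" where
  "simplex_integral 0 b F = F []"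
| "simplex_integral (Suc n) b F =
     integral {0..b} (\<lambda>t. simplex_integral n t (\<lambda>ts. F (t # ts)))"

text \<open>
  Integrals of operators are taken in the strong sense, i.e. after application to a vector;
  \<open>foldr A [t1, ..., tn] x\<close> is \<open>A t1 (A t2 (... (A tn x)))\<close>.
\<close>

definition Dyson :: "(real \<Rightarrow> 'a::complex_inner \<Rightarrow> 'a) \<Rightarrow> nat \<Rightarrow> 'a \<Rightarrow> 'a" where
  "Dyson A n x = simplex_integral n 1 (\<lambda>ts. foldr A ts x)"

definition compositions :: "nat \<Rightarrow> nat \<Rightarrow> nat list set" where
  "compositions k m = {ns. length ns = k \<and> sum_list ns = m \<and> (\<forall>n\<in>set ns. n \<ge> 1)}"

lemma finite_compositions: "finite (compositions k m)"
proof (rule finite_subset)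
  show "compositions k m \<subseteq> {ns. set ns \<subseteq> {..m} \<and> length ns = k}"
    by (auto simp: compositions_def member_le_sum_list)
qed (simp add: finite_lists_length_eq)

definition FM :: "nat \<Rightarrow> (real \<Rightarrow> 'a::complex_inner \<Rightarrow> 'a) \<Rightarrow> 'a \<Rightarrow> 'a" where
  "FM l A x =
     (\<i> * (- \<i>) ^ (l + 1)) *\<^sub>C
       (\<Sum>k=1..l+1. ((- 1) ^ (k - 1) / of_nat k) *\<^sub>C
          (\<Sum>ns\<in>compositions k (l + 1). foldr (Dyson A) ns x))"

definition FM_eff ::
    "real \<Rightarrow> nat \<Rightarrow> (real \<Rightarrow> 'a::complex_inner \<Rightarrow> 'a) \<Rightarrow> 'a \<Rightarrow> 'a" where
  "FM_eff T L A x = (\<Sum>l=0..L. T ^ l *\<^sub>R FM l A x)"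

text \<open>
  The truncation \<open>P\<^sub>N A(t) P\<^sub>N\<close>, extended by zero from the range of \<open>P\<^sub>N\<close> to the whole space.
\<close>

definition truncated ::
    "'a::complex_inner set \<Rightarrow> ('a \<Rightarrow> 'a) \<Rightarrow> real \<Rightarrow> (real \<Rightarrow> 'a \<Rightarrow> 'a) \<Rightarrow> real \<Rightarrow> 'a \<Rightarrow> 'a" where
  "truncated D0 H0 N A t = spec_proj D0 H0 N \<circ> A t \<circ> spec_proj D0 H0 N"

end

theory Submission
  imports Defs
begin

text \<open>
  Write \<open>J s\<close> for \<open>(1 + H0)\<close> to the power \<open>-s\<close>.  By the spectral theorem for the compact resolvent
  it maps the Hilbert space isometrically onto the scale space of order \<open>s\<close>, so the hypotheses say that
  \<open>H(t) J(s + \<mu>) = J(s) B(s, t)\<close> with bounded operators \<open>B(s, t)\<close> that are norm-continuous in \<open>t\<close>.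
  The spectral projections \<open>P\<^sub>N\<close> commute with \<open>J s\<close>, are contractions and tend strongly to the identity.
  Hence \<open>P\<^sub>N B(s, t) P\<^sub>N y\<close> is jointly continuous in \<open>(N, t, y)\<close> when \<open>N\<close> runs through a sequence
  tending to \<open>\<infinity>\<close> together with its limit.  Composition, summation and integration over simplices
  preserve continuous dependence on parameters, so the Floquet--Magnus vectors are continuous in \<open>N\<close>
  up to and including \<open>N = \<infinity>\<close>, and the convergence is continuity at that point.
\<close>

section \<open>Real Hilbert spaces\<close>

text \<open>A minimizing sequence for the distance from \<open>x\<close> to \<open>M\<close> is
  Cauchy by the parallelogram law, since midpoints stay in \<open>M\<close>. Its limit attains the
  distance, and varying it along \<open>m\<close> forces orthogonality.\<close>

lemma ex_orthogonal_projection: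
  fixes M :: "'a::{real_inner, banach} set"
  assumes M: "subspace M" "closed M"
  shows "\<exists>p\<in>M. \<forall>m\<in>M. inner m (x - p) = 0"
proof -
  define d where "d = infdist x M"
  have ne: "M \<noteq> {}"
    using subspace_0[OF M(1)] by auto
  have d_le: "d \<le> norm (x - m)" if "m \<in> M" for m
    unfolding d_def dist_norm[symmetric] by (rule infdist_le[OF that])
  have d0: "d \<ge> 0"
    unfolding d_def by (rule infdist_nonneg)
  have "\<exists>p\<in>M. norm (x - p) < sqrt (d\<^sup>2 + inverse (real (Suc n)))" for n
  proof -
    have "d < sqrt (d\<^sup>2 + inverse (real (Suc n)))"
      using d0 by (intro real_less_rsqrt) simp
    then have "(INF a\<in>M. dist x a) < sqrt (d\<^sup>2 + inverse (real (Suc n)))"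
      using ne by (simp add: d_def infdist_def)
    then show ?thesis
      by (subst (asm) cInf_less_iff) (auto simp: ne dist_norm intro: bdd_belowI2[of _ 0])
  qed
  then obtain p where pM: "\<And>n. p n \<in> M"
    and p_less: "\<And>n. norm (x - p n) < sqrt (d\<^sup>2 + inverse (real (Suc n)))"
    by metis
  have p_sq: "(norm (x - p n))\<^sup>2 < d\<^sup>2 + inverse (real (Suc n))" for n
    using real_sqrt_less_iff[of "(norm (x - p n))\<^sup>2"] p_less[of n] by simp
  have pp: "(norm (p n - p m))\<^sup>2 \<le> 2 * inverse (real (Suc n)) + 2 * inverse (real (Suc m))" for n m
  proof -
    have "(1/2) *\<^sub>R (p n + p m) \<in> M"
      using M(1) pM by (intro subspace_scale subspace_add)
    then have "d\<^sup>2 \<le> (norm (x - (1/2) *\<^sub>R (p n + p m)))\<^sup>2"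
      using d0 by (intro power_mono d_le)
    moreover have "(norm (p n - p m))\<^sup>2 =
      2 * (norm (x - p n))\<^sup>2 + 2 * (norm (x - p m))\<^sup>2 - 4 * (norm (x - (1/2) *\<^sub>R (p n + p m)))\<^sup>2"
      by (simp add: power2_norm_eq_inner inner_simps inner_commute algebra_simps)
    ultimately show ?thesis
      using p_sq[of n] p_sq[of m] by linarith
  qed
  have "Cauchy p"
  proof (rule metric_CauchyI)
    fix e :: real assume e: "e > 0"
    then obtain N where N: "inverse (real (Suc N)) < e\<^sup>2 / 4"
      using reals_Archimedean[of "e\<^sup>2 / 4"] by auto
    have "dist (p m) (p n) < e" if "m \<ge> N" "n \<ge> N" for m n
    proof -
      have "inverse (real (Suc m)) \<le> inverse (real (Suc N))" "inverse (real (Suc n)) \<le> inverse (real (Suc N))"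
        using that by (auto simp: field_simps)
      with pp[of m n] N have "(norm (p m - p n))\<^sup>2 < e\<^sup>2"
        by linarith
      then show ?thesis
        using e by (simp add: dist_norm power2_less_imp_less)
    qed
    then show "\<exists>N. \<forall>m\<ge>N. \<forall>n\<ge>N. dist (p m) (p n) < e" by blast
  qed
  then obtain q where q: "p \<longlonglongrightarrow> q"
    using Cauchy_convergent convergent_def by blast
  have qM: "q \<in> M"
    using closed_sequentially[OF M(2) _ q] pM by blast
  have "(\<lambda>n. d\<^sup>2 + inverse (real (Suc n))) \<longlonglongrightarrow> d\<^sup>2 + 0"
    by (intro tendsto_intros LIMSEQ_inverse_real_of_nat)
  moreover have "(\<lambda>n. (norm (x - p n))\<^sup>2) \<longlonglongrightarrow> (norm (x - q))\<^sup>2"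
    by (intro tendsto_intros q)
  ultimately have dq: "(norm (x - q))\<^sup>2 \<le> d\<^sup>2"
    using p_sq by (intro LIMSEQ_le) (auto intro: less_imp_le)
  have "inner m (x - q) = 0" if m: "m \<in> M" for m
  proof (rule ccontr)
    assume n0: "inner m (x - q) \<noteq> 0"
    then have "m \<noteq> 0" by auto
    \<comment> \<open>This \<open>t\<close> minimizes the quadratic norm of
      \<open>x - q - t *\<^sub>R m\<close>, so a nonzero inner product would strictly beat the
      distance \<open>d\<close>.\<close>
    define t where "t = inner m (x - q) / inner m m"
    have "q + t *\<^sub>R m \<in> M"
      using M(1) qM m by (intro subspace_add subspace_scale)
    then have "d\<^sup>2 \<le> (norm (x - (q + t *\<^sub>R m)))\<^sup>2"
      using d0 by (intro power_mono d_le)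
    also have "x - (q + t *\<^sub>R m) = (x - q) - t *\<^sub>R m"
      by simp
    also have "(norm \<dots>)\<^sup>2 = (norm (x - q))\<^sup>2 - 2 * t * inner m (x - q) + t * t * inner m m"
      unfolding power2_norm_eq_inner inner_diff_left[of "x - q"] inner_diff_right[of _ "x - q"]
      by (simp add: inner_commute[of "x - q" m])
    also have "\<dots> = (norm (x - q))\<^sup>2 - (inner m (x - q))\<^sup>2 / inner m m"
      using \<open>m \<noteq> 0\<close> by (simp add: t_def power2_eq_square)
    also have "\<dots> < (norm (x - q))\<^sup>2"
      using n0 \<open>m \<noteq> 0\<close> by simp
    finally show False using dq by simp
  qed
  with qM show ?thesis by blast
qed

text \<open>By Pythagoras, the change of a partial sum is controlled by the change of the numerical
  series of squares. The net of finite partial sums is therefore Cauchy, and completeness supplies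
  the limit.\<close>

lemma orthogonal_summable_on:
  fixes f :: "'i \<Rightarrow> 'a::{real_inner, banach}"
  assumes orth: "pairwise (\<lambda>i j. orthogonal (f i) (f j)) A"
    and sq: "(\<lambda>i. (norm (f i))\<^sup>2) summable_on A"
  shows "f summable_on A"
proof -
  let ?F = "finite_subsets_at_top A" and ?s = "\<lambda>F. \<Sum>i\<in>F. (norm (f i))\<^sup>2"
  obtain L where L: "((\<lambda>i. (norm (f i))\<^sup>2) has_sum L) A"
    using sq by (auto simp: summable_on_def)
  have pyth: "(norm (sum f F))\<^sup>2 = ?s F" if "finite F" "F \<subseteq> A" for F
    using that orth by (intro norm_sum_Pythagorean) (auto intro: pairwise_subset)
  have "\<exists>P. eventually P ?F \<and> (\<forall>F G. P F \<and> P G \<longrightarrow> dist (sum f F) (sum f G) < e)"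
    if e: "e > 0" for e
  proof -
    from has_sum_finite_approximation[OF L, of "e\<^sup>2 / 8"] e
    obtain F0 where F0: "finite F0" "F0 \<subseteq> A" "\<bar>?s F0 - L\<bar> \<le> e\<^sup>2 / 8"
      by (auto simp: dist_real_def)
    have near: "norm (sum f F - sum f F0) < e / 2" if "finite F" "F0 \<subseteq> F" "F \<subseteq> A" for F
    proof -
      have "sum f F - sum f F0 = sum f (F - F0)"
        using that by (simp add: sum_diff)
      then have "(norm (sum f F - sum f F0))\<^sup>2 = ?s (F - F0)"
        using pyth[of "F - F0"] that by auto
      also have "\<dots> = ?s F - ?s F0"
        using that by (simp add: sum_diff)
      also have "\<dots> \<le> L - ?s F0"
        using finite_sum_le_has_sum[OF L that(1,3)] by simp
      also have "\<dots> \<le> e\<^sup>2 / 8"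
        using F0(3) by linarith
      \<comment> \<open>The tolerance \<open>e\<^sup>2 / 8\<close> was chosen strictly below
        \<open>(e / 2)\<^sup>2\<close>, so that two such deviations stay below
        \<open>e\<close>.\<close>
      also have "\<dots> < (e / 2)\<^sup>2"
        using e by (simp add: power2_eq_square)
      finally show ?thesis
        by (rule power2_less_imp_less) (use e in simp)
    qed
    have "dist (sum f F) (sum f G) < e"
      if "finite F" "F0 \<subseteq> F" "F \<subseteq> A" "finite G" "F0 \<subseteq> G" "G \<subseteq> A" for F G
      using near[OF that(1-3)] near[OF that(4-6)] dist_triangle2[of "sum f F" "sum f G" "sum f F0"]
      unfolding dist_norm by linarith
    moreover have "\<forall>\<^sub>F F in ?F. finite F \<and> F0 \<subseteq> F \<and> F \<subseteq> A"
      unfolding eventually_finite_subsets_at_top using F0(1,2) by blast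
    ultimately show ?thesis
      by (intro exI[of _ "\<lambda>F. finite F \<and> F0 \<subseteq> F \<and> F \<subseteq> A"]) blast
  qed
  then have "cauchy_filter (filtermap (sum f) ?F)"
    by (simp add: cauchy_filter_metric_filtermap)
  moreover have "complete (UNIV :: 'a set)"
    by (meson Cauchy_convergent UNIV_I complete_def convergent_def)
  ultimately obtain z where "(sum f \<longlongrightarrow> z) ?F"
    using complete_uniform[where S = UNIV] by (force simp add: filterlim_def)
  then show ?thesis
    using summable_on_def has_sum_def by blast
qed

lemma has_sum_orthogonal_norm:
  fixes f :: "'i \<Rightarrow> 'a::real_inner"
  assumes orth: "pairwise (\<lambda>i j. orthogonal (f i) (f j)) A" and f: "(f has_sum s) A"
  shows "((\<lambda>i. (norm (f i))\<^sup>2) has_sum (norm s)\<^sup>2) A"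
  unfolding has_sum_def
proof (rule Lim_transform_eventually)
  show "((\<lambda>F. (norm (sum f F))\<^sup>2) \<longlongrightarrow> (norm s)\<^sup>2) (finite_subsets_at_top A)"
    using f by (auto simp: has_sum_def intro!: tendsto_intros)
  show "\<forall>\<^sub>F F in finite_subsets_at_top A. (norm (sum f F))\<^sup>2 = (\<Sum>i\<in>F. (norm (f i))\<^sup>2)"
    using orth by (intro eventually_finite_subsets_at_top_weakI norm_sum_Pythagorean)
      (auto intro: pairwise_subset)
qed

text \<open>
  On the invariant subspace \<open>M\<close> a maximizing sequence for \<open>norm (K x)\<close> on the unit ball makes
  \<open>K (K x) - c\<^sup>2 x\<close> small, where \<open>c\<close> is the norm of \<open>K\<close> on \<open>M\<close>; compactness then gives an
  eigenvector of \<open>K \<circ> K\<close>, and \<open>K\<^sup>2 - c\<^sup>2 = (K - c) (K + c)\<close> gives one of \<open>K\<close>.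
\<close>

lemma compact_symmetric_ex_eigenvector:
  fixes K :: "'a::real_inner \<Rightarrow> 'a"
  assumes K: "bounded_linear K" and sym: "\<And>x y. inner (K x) y = inner x (K y)"
    and compact: "\<And>X::nat \<Rightarrow> 'a. bounded (range X) \<Longrightarrow> \<exists>\<sigma> v. strict_mono \<sigma> \<and> (\<lambda>n. K (X (\<sigma> n))) \<longlonglongrightarrow> v"
    and M: "subspace M" "closed M" and inv: "K ` M \<subseteq> M" and y: "y \<in> M" "K y \<noteq> 0"
  shows "\<exists>x\<in>M. \<exists>\<kappa>. x \<noteq> 0 \<and> \<kappa> \<noteq> 0 \<and> K x = \<kappa> *\<^sub>R x"
proof -
  interpret K: bounded_linear K by fact
  define S where "S = {x \<in> M. norm x \<le> 1}"
  define c where "c = (SUP x\<in>S. norm (K x))"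
  have bdd: "bdd_above ((\<lambda>x. norm (K x)) ` S)"
  proof (rule bdd_aboveI2)
    fix x assume "x \<in> S"
    then have "norm x \<le> 1" by (simp add: S_def)
    then show "norm (K x) \<le> onorm K * 1"
      using onorm[OF K, of x] onorm_pos_le[OF K] by (meson mult_left_mono order_trans)
  qed
  have c_upper: "norm (K x) \<le> c" if "x \<in> S" for x
    unfolding c_def by (rule cSUP_upper[OF that bdd])
  have normalized: "(1 / norm x) *\<^sub>R x \<in> S" if "x \<in> M" for x
    using that M(1) by (simp add: S_def subspace_scale)
  have Kc: "norm (K x) \<le> c * norm x" if "x \<in> M" for x
  proof (cases "x = 0")
    case False
    with c_upper[OF normalized[OF that]] show ?thesis
      by (simp add: K.scaleR field_simps)
  qed (simp add: K.zero)
  have "y \<noteq> 0" using y(2) K.zero by auto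
  have c: "c > 0"
  proof -
    have "0 < norm (K y)" using y(2) by simp
    also have "\<dots> \<le> c * norm y" by (rule Kc[OF y(1)])
    finally show ?thesis
      using zero_less_mult_pos2 \<open>y \<noteq> 0\<close> by fastforce
  qed
  have "\<exists>x\<in>S. c - inverse (real (Suc n)) < norm (K x)" for n
    using less_cSUP_iff[OF _ bdd, of "c - inverse (real (Suc n))"] normalized[OF y(1)]
    by (auto simp: c_def[symmetric])
  then obtain X where X: "\<And>n. X n \<in> S" "\<And>n. c - inverse (real (Suc n)) < norm (K (X n))"
    by metis
  have "bounded (range X)"
    using X(1) by (auto simp: bounded_iff S_def)
  from compact[OF this] obtain \<sigma> v where \<sigma>: "strict_mono \<sigma>" and v: "(\<lambda>n. K (X (\<sigma> n))) \<longlonglongrightarrow> v"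
    by blast
  have "(\<lambda>n. norm (K (X n))) \<longlonglongrightarrow> c"
  proof (rule tendsto_sandwich)
    have "(\<lambda>n. c - inverse (real (Suc n))) \<longlonglongrightarrow> c - 0"
      by (intro tendsto_intros LIMSEQ_inverse_real_of_nat)
    then show "(\<lambda>n. c - inverse (real (Suc n))) \<longlonglongrightarrow> c" by simp
    show "\<forall>\<^sub>F n in sequentially. c - inverse (real (Suc n)) \<le> norm (K (X n))"
      using X(2) by (intro always_eventually allI less_imp_le)
    show "\<forall>\<^sub>F n in sequentially. norm (K (X n)) \<le> c"
      by (intro always_eventually allI c_upper X(1))
  qed (rule tendsto_const)
  then have normK: "(\<lambda>n. norm (K (X (\<sigma> n)))) \<longlonglongrightarrow> c"
    using LIMSEQ_subseq_LIMSEQ[OF _ \<sigma>] by (auto simp: o_def)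
  have "norm v = c"
    using LIMSEQ_unique[OF tendsto_norm[OF v] normK] .
  then have v0: "v \<noteq> 0" using c by auto
  have SM: "X n \<in> M" "norm (X n) \<le> 1" for n
    using X(1) by (auto simp: S_def)
  then have KM: "K (X n) \<in> M" for n
    using inv by blast
  have vM: "v \<in> M"
    using closed_sequentially[OF M(2) _ v] KM by blast
  \<comment> \<open>After expanding the square, symmetry evaluates the cross term, and the bounds by
    \<open>c\<close> leave a quantity that vanishes along the maximizing sequence.\<close>
  have est: "(norm (K (K x) - c\<^sup>2 *\<^sub>R x))\<^sup>2 \<le> c^4 - c\<^sup>2 * (norm (K x))\<^sup>2"
    if "x \<in> M" "norm x \<le> 1" for x
  proof -
    have "(norm (K (K x)))\<^sup>2 \<le> (c * norm (K x))\<^sup>2"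
      using inv that by (intro power_mono Kc) auto
    moreover have "c^4 * (norm x)\<^sup>2 \<le> c^4 * 1"
      using that by (intro mult_left_mono) (auto simp: power_le_one)
    moreover have "(norm (K (K x) - c\<^sup>2 *\<^sub>R x))\<^sup>2 =
      (norm (K (K x)))\<^sup>2 - 2 * c\<^sup>2 * (norm (K x))\<^sup>2 + c^4 * (norm x)\<^sup>2"
    proof -
      have "(norm (K (K x) - d *\<^sub>R x))\<^sup>2 = (norm (K (K x)))\<^sup>2 - 2 * d * (norm (K x))\<^sup>2 + d * d * (norm x)\<^sup>2"
        for d
        using sym[of "K x" x]
        by (simp add: power2_norm_eq_inner inner_simps inner_commute algebra_simps)
      from this[of "c\<^sup>2"] show ?thesis
        by (simp add: power2_eq_square power4_eq_xxxx)
    qed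
    ultimately show ?thesis
      by (simp add: power_mult_distrib)
  qed
  have "(\<lambda>n. c^4 - c\<^sup>2 * (norm (K (X (\<sigma> n))))\<^sup>2) \<longlonglongrightarrow> c^4 - c\<^sup>2 * c\<^sup>2"
    by (intro tendsto_intros normK)
  then have "(\<lambda>n. c^4 - c\<^sup>2 * (norm (K (X (\<sigma> n))))\<^sup>2) \<longlonglongrightarrow> 0"
    by (simp add: power4_eq_xxxx power2_eq_square)
  then have "(\<lambda>n. (norm (K (K (X (\<sigma> n))) - c\<^sup>2 *\<^sub>R X (\<sigma> n)))\<^sup>2) \<longlonglongrightarrow> 0"
    by (rule tendsto_sandwich[OF _ _ tendsto_const, rotated 2])
       (use est SM in \<open>auto intro!: always_eventually\<close>)
  then have "(\<lambda>n. K (K (X (\<sigma> n))) - c\<^sup>2 *\<^sub>R X (\<sigma> n)) \<longlonglongrightarrow> 0"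
    by (simp add: tendsto_norm_zero_iff)
  \<comment> \<open>The sequence \<open>X (\<sigma> n)\<close> itself need not converge. One more
    application of \<open>K\<close> leaves only expressions in \<open>K (X (\<sigma> n))\<close>,
    which does.\<close>
  from K.tendsto[OF this] have "(\<lambda>n. K (K (K (X (\<sigma> n)))) - c\<^sup>2 *\<^sub>R K (X (\<sigma> n))) \<longlonglongrightarrow> 0"
    by (simp add: K.diff K.scaleR K.zero)
  moreover have "(\<lambda>n. K (K (K (X (\<sigma> n)))) - c\<^sup>2 *\<^sub>R K (X (\<sigma> n))) \<longlonglongrightarrow> K (K v) - c\<^sup>2 *\<^sub>R v"
    by (intro tendsto_intros K.tendsto v)
  ultimately have KKv: "K (K v) = c\<^sup>2 *\<^sub>R v"
    using LIMSEQ_unique by fastforce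
  define w where "w = K v + c *\<^sub>R v"
  show ?thesis
  proof (cases "w = 0")
    case True
    then have "K v = (- c) *\<^sub>R v"
      by (simp add: w_def eq_neg_iff_add_eq_0)
    with v0 vM c show ?thesis
      by (intro bexI[of _ v] exI[of _ "- c"]) auto
  next
    case False
    have "w \<in> M"
      using M(1) vM inv by (auto simp: w_def intro!: subspace_add subspace_scale)
    moreover have "K w = c *\<^sub>R w"
      by (simp add: w_def K.add K.scaleR KKv scaleR_add_right power2_eq_square add.commute)
    ultimately show ?thesis
      using False c by (intro bexI[of _ w] exI[of _ c]) auto
  qed
qed

section \<open>Iterated integrals depending on parameters\<close>

lemma scaleC_one [simp]: "(1::complex) *\<^sub>C x = (x::'a::complex_inner)"
  using scaleC_of_real[of 1 x] by simp

lemma scaleC_scaleR: "c *\<^sub>C (a *\<^sub>R x) = a *\<^sub>R (c *\<^sub>C (x::'a::complex_inner))"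
  unfolding scaleC_of_real[symmetric] scaleC_scaleC by (simp add: mult.commute)

lemma norm_scaleC: "norm (c *\<^sub>C x) = cmod c * norm (x::'a::complex_inner)"
proof -
  have "cinner (c *\<^sub>C x) (c *\<^sub>C x) = c * cnj (cinner x (c *\<^sub>C x))"
    by (metis cinner_commute cinner_scaleC_right)
  also have "\<dots> = (c * cnj c) * cinner x x"
    by (simp add: cinner_scaleC_right cinner_commute[of x x, symmetric] mult.assoc)
  finally have "Re (cinner (c *\<^sub>C x) (c *\<^sub>C x)) = (cmod c)\<^sup>2 * Re (cinner x x)"
    by (simp add: complex_mult_cnj cmod_power2)
  then have "(norm (c *\<^sub>C x))\<^sup>2 = (cmod c * norm x)\<^sup>2"
    by (simp add: Re_cinner power2_norm_eq_inner power_mult_distrib)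
  then show ?thesis
    by (rule power2_eq_imp_eq) auto
qed

lemma bounded_linear_scaleC: "bounded_linear (\<lambda>x::'a::complex_inner. c *\<^sub>C x)"
  by (rule bounded_linear_intro[where K = "cmod c"])
     (simp_all add: scaleC_add_right scaleC_scaleR norm_scaleC mult.commute)

text \<open>The substitution of \<open>b * t\<close> for \<open>t\<close> moves the variable
  endpoint into the integrand, so that continuity of integrals over a fixed interval in a parameter
  applies.\<close>

lemma continuous_on_integral_upper_bound:
  fixes f :: "'p::topological_space \<Rightarrow> real \<Rightarrow> 'b::banach"
  assumes "continuous_on (U \<times> {0..1}) (\<lambda>(e, t). f e t)"
  shows "continuous_on (U \<times> {0..1}) (\<lambda>(e, b). integral {0..b} (f e))"
proof -
  have eq: "integral {0..b} (f e) = b *\<^sub>R integral {0..1} (\<lambda>t. f e (b * t))"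
    if "e \<in> U" "b \<in> {0..1}" for e b
  \<comment> \<open>The affine substitution requires \<open>b > 0\<close>; at \<open>b = 0\<close>
    both sides vanish.\<close>
  proof (cases "b = 0")
    case False
    with that have b: "b > 0" by auto
    have "continuous_on {0..b} (f e)"
      using that by (intro continuous_on_compose2[OF assms, of "{0..b}" "\<lambda>t. (e, t)", simplified])
        (auto intro!: continuous_intros)
    then have "f e integrable_on cbox 0 b"
      by (metis integrable_continuous_real cbox_interval)
    then have "(f e has_integral integral {0..b} (f e)) (cbox 0 b)"
      by (metis integrable_integral cbox_interval)
    from has_integral_affinity'[OF this b, of 0]
    have "((\<lambda>t. f e (b * t)) has_integral integral {0..b} (f e) /\<^sub>R b) {0..1}"
      using b by simp
    then show ?thesis
      using b by (simp add: integral_unique)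
  qed simp
  have "continuous_on ((U \<times> {0..1::real}) \<times> cbox 0 1) (\<lambda>(p, t). f (fst p) (snd p * t))"
    unfolding case_prod_beta
    by (intro continuous_on_compose2[OF assms, of _ "\<lambda>q. (fst (fst q), snd (fst q) * snd q)",
          unfolded case_prod_beta fst_conv snd_conv])
       (auto simp: mult_le_one intro!: continuous_intros)
  from integral_continuous_on_param[OF this]
  have "continuous_on (U \<times> {0..1::real})
          (\<lambda>p. snd p *\<^sub>R integral {0..1} (\<lambda>t. f (fst p) (snd p * t)))"
    by (auto intro!: continuous_intros simp del: box_real simp: cbox_interval)
  then show ?thesis
    by (rule continuous_on_eq) (auto simp: eq)
qed

text \<open>
  With \<open>j = J s\<close> this says that \<open>g\<close> takes values in the scale space of order \<open>s\<close> and is continuous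
  for its norm, without mentioning that norm.
\<close>

definition lifts :: "('b::topological_space \<Rightarrow> 'a) \<Rightarrow> 'p::topological_space set \<Rightarrow> ('p \<Rightarrow> 'a) \<Rightarrow> bool" where
  "lifts j U g \<longleftrightarrow> (\<exists>z. continuous_on U z \<and> (\<forall>e\<in>U. g e = j (z e)))"

lemma liftsI: "continuous_on U z \<Longrightarrow> (\<And>e. e \<in> U \<Longrightarrow> g e = j (z e)) \<Longrightarrow> lifts j U g"
  unfolding lifts_def by blast

lemma lifts_cong: "lifts j U g \<Longrightarrow> (\<And>e. e \<in> U \<Longrightarrow> g e = h e) \<Longrightarrow> lifts j U h"
  unfolding lifts_def by metis

lemma lifts_compose:
  assumes "lifts j U g" "continuous_on V h" "h ` V \<subseteq> U"
  shows "lifts j V (\<lambda>e. g (h e))"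
proof -
  from assms(1) obtain z where "continuous_on U z" "\<forall>e\<in>U. g e = j (z e)"
    unfolding lifts_def by blast
  with assms(2,3) show ?thesis
    by (intro liftsI[of V "\<lambda>e. z (h e)"]) (auto intro: continuous_on_compose2)
qed

lemma lifts_sum:
  assumes "bounded_linear j" "\<And>i. i \<in> I \<Longrightarrow> lifts j U (g i)"
  shows "lifts j U (\<lambda>e. \<Sum>i\<in>I. g i e)"
proof -
  from assms(2) obtain z where z: "\<And>i. i \<in> I \<Longrightarrow> continuous_on U (z i)"
    "\<And>i e. i \<in> I \<Longrightarrow> e \<in> U \<Longrightarrow> g i e = j (z i e)"
    unfolding lifts_def by metis
  show ?thesis
    by (rule liftsI[of U "\<lambda>e. \<Sum>i\<in>I. z i e"])
       (auto intro!: continuous_intros z sum.cong simp: z linear_sum[OF bounded_linear.linear[OF assms(1)]])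
qed

lemma lifts_scaleC:
  fixes j :: "'a::complex_inner \<Rightarrow> 'a"
  assumes "\<And>x. j (c *\<^sub>C x) = c *\<^sub>C j x" "lifts j U g"
  shows "lifts j U (\<lambda>e. c *\<^sub>C g e)"
proof -
  from assms(2) obtain z where z: "continuous_on U z" "\<forall>e\<in>U. g e = j (z e)"
    unfolding lifts_def by blast
  show ?thesis
    by (rule liftsI[of U "\<lambda>e. c *\<^sub>C z e"])
       (auto intro!: bounded_linear.continuous_on[OF bounded_linear_scaleC] simp: z assms)
qed

text \<open>A bounded operator passes through the integral, so integrating the continuous lift of
  the integrand yields a lift of the integral.\<close>

lemma lifts_integral:
  fixes j :: "'b::banach \<Rightarrow> 'c::banach" and g :: "'p::topological_space \<Rightarrow> real \<Rightarrow> 'c"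
  assumes j: "bounded_linear j" and "lifts j (U \<times> {0..1}) (\<lambda>(e, t). g e t)"
  shows "lifts j (U \<times> {0..1}) (\<lambda>(e, b). integral {0..b} (g e))"
proof -
  from assms(2) obtain z where z: "continuous_on (U \<times> {0..1}) (\<lambda>(e, t). z e t)"
    and gz: "\<And>e t. e \<in> U \<Longrightarrow> t \<in> {0..1} \<Longrightarrow> g e t = j (z e t)"
    unfolding lifts_def by (metis (no_types, lifting) case_prod_conv mem_Sigma_iff case_prod_eta curry_conv)
  have "integral {0..b} (g e) = j (integral {0..b} (z e))" if "e \<in> U" "b \<in> {0..1}" for e b
  proof -
    have "continuous_on {0..b} (z e)"
      using that by (intro continuous_on_compose2[OF z, of "{0..b}" "\<lambda>t. (e, t)", unfolded case_prod_conv])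
        (auto intro!: continuous_intros)
    then have "z e integrable_on {0..b}"
      by (rule integrable_continuous_real)
    from integral_linear[OF this j] have "integral {0..b} (\<lambda>t. j (z e t)) = j (integral {0..b} (z e))"
      by (simp add: o_def)
    moreover have "integral {0..b} (g e) = integral {0..b} (\<lambda>t. j (z e t))"
      using that by (intro integral_cong) (auto simp: gz)
    ultimately show ?thesis by simp
  qed
  then show ?thesis
    by (intro liftsI[OF continuous_on_integral_upper_bound[OF z]]) auto
qed

section \<open>Iterated integrals and loss of regularity on an abstract scale\<close>

text \<open>
  The same iterated integral as in \<open>Dyson\<close>, but with each \<open>A t\<close> applied after the inner integration.
\<close>

primrec Volterra :: "(real \<Rightarrow> 'a::real_normed_vector \<Rightarrow> 'a) \<Rightarrow> nat \<Rightarrow> real \<Rightarrow> 'a \<Rightarrow> 'a" where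
  "Volterra A 0 b x = x"
| "Volterra A (Suc n) b x = integral {0..b} (\<lambda>t. A t (Volterra A n t x))"

text \<open>The parameter \<open>e\<close> will be the truncation level. The relation
  \<open>intertwine\<close> encodes that \<open>A e t\<close> loses \<mu> orders of regularity.
  Continuity of \<open>B\<close> is joint in the vector as well, because truncations converge only
  strongly and not in operator norm.\<close>

locale scale_family =
  fixes J :: "real \<Rightarrow> 'a::complex_hilbert \<Rightarrow> 'a" and \<mu> :: real
    and U :: "'p::topological_space set"
    and A :: "'p \<Rightarrow> real \<Rightarrow> 'a \<Rightarrow> 'a" and B :: "real \<Rightarrow> 'p \<Rightarrow> real \<Rightarrow> 'a \<Rightarrow> 'a"
  assumes mu: "\<mu> \<ge> 0"
    and J_bounded_linear: "s \<ge> 0 \<Longrightarrow> bounded_linear (J s)"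
    and J_scaleC: "s \<ge> 0 \<Longrightarrow> J s (c *\<^sub>C x) = c *\<^sub>C J s x"
    and intertwine: "s \<ge> 0 \<Longrightarrow> e \<in> U \<Longrightarrow> t \<in> {0..1} \<Longrightarrow> A e t (J (s + \<mu>) y) = J s (B s e t y)"
    and B_bounded_linear: "s \<ge> 0 \<Longrightarrow> e \<in> U \<Longrightarrow> t \<in> {0..1} \<Longrightarrow> bounded_linear (B s e t)"
    and B_continuous: "s \<ge> 0 \<Longrightarrow> continuous_on (U \<times> {0..1} \<times> UNIV) (\<lambda>(e, t, y). B s e t y)"
begin

text \<open>By \<open>intertwine\<close>, applying \<open>B s e t\<close> to a lift at level
  \<open>s + \<mu>\<close> gives a lift at level \<open>s\<close>; joint continuity of
  \<open>B\<close> keeps it continuous.\<close>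

lemma lifts_apply:
  assumes s: "s \<ge> 0" and g: "lifts (J (s + \<mu>)) (U \<times> {0..1}) (\<lambda>(e, t). g e t)"
  shows "lifts (J s) (U \<times> {0..1}) (\<lambda>(e, t). A e t (g e t))"
proof -
  from g obtain z where z: "continuous_on (U \<times> {0..1}) z"
    "\<And>e t. e \<in> U \<Longrightarrow> t \<in> {0..1} \<Longrightarrow> g e t = J (s + \<mu>) (z (e, t))"
    unfolding lifts_def by auto
  have "continuous_on (U \<times> {0..1}) (\<lambda>p. B s (fst p) (snd p) (z p))"
    by (intro continuous_on_compose2[OF B_continuous[OF s], of "U \<times> {0..1}" "\<lambda>p. (fst p, snd p, z p)",
          simplified case_prod_beta fst_conv snd_conv])
       (auto intro!: continuous_intros z)
  then show ?thesis
    by (rule liftsI) (auto simp: z intertwine s)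
qed

text \<open>Each of the \<open>n\<close> factors costs \<mu>. The level \<open>s\<close> is
  generalized in the induction because the inner integral is needed one level higher.\<close>

lemma lifts_Volterra:
  assumes "s \<ge> 0" "lifts (J (s + real n * \<mu>)) U x"
  shows "lifts (J s) (U \<times> {0..1}) (\<lambda>(e, b). Volterra (A e) n b (x e))"
  using assms
proof (induction n arbitrary: s)
  case 0
  then show ?case
    using lifts_compose[of "J s" U x "U \<times> {0..1::real}" fst, OF _ continuous_on_fst[OF continuous_on_id]]
    by (auto simp: case_prod_beta)
next
  case (Suc n)
  have "lifts (J (s + \<mu>)) (U \<times> {0..1}) (\<lambda>(e, b). Volterra (A e) n b (x e))"
    using Suc.prems mu by (intro Suc.IH) (auto simp: algebra_simps)
  from lifts_integral[OF J_bounded_linear lifts_apply[OF _ this]] Suc.prems(1)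
  show ?case by simp
qed

text \<open>The operators to the left of the current integration are collected in \<open>C\<close>.
  It may be unbounded, but \<open>C\<close> after \<open>J s\<close> is bounded, and the integrand
  has a continuous lift; this lets \<open>C\<close> be pulled out of each integral.\<close>

lemma simplex_integral_Volterra:
  assumes "s \<ge> 0" "bounded_linear (\<lambda>w. C (J s w))" "e \<in> U" "b \<in> {0..1}"
    "x = J (s + real n * \<mu>) y"
  shows "simplex_integral n b (\<lambda>ts. C (foldr (A e) ts x)) = C (Volterra (A e) n b x)"
  using assms
proof (induction n arbitrary: s b C)
  case (Suc n)
  have IH: "simplex_integral n t (\<lambda>ts. C (A e t (foldr (A e) ts x))) = C (A e t (Volterra (A e) n t x))"
    if t: "t \<in> {0..1}" for t
  proof (rule Suc.IH[of "s + \<mu>"])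
    \<comment> \<open>Trading \<open>A e t\<close> for the bounded \<open>B s e t\<close> shows that
      the enlarged outer operator is again bounded after \<open>J\<close>, now at level
      \<open>s + \<mu>\<close>.\<close>
    have "(\<lambda>w. C (A e t (J (s + \<mu>) w))) = (\<lambda>w. C (J s (B s e t w)))"
      using Suc.prems t by (simp add: intertwine)
    then show "bounded_linear (\<lambda>w. C (A e t (J (s + \<mu>) w)))"
      using bounded_linear_compose[OF Suc.prems(2) B_bounded_linear[of s e t]] Suc.prems t by simp
    show "x = J (s + \<mu> + real n * \<mu>) y"
      using Suc.prems(5) by (simp add: algebra_simps)
  qed (use Suc.prems t mu in auto)
  have "lifts (J (s + \<mu> + real n * \<mu>)) U (\<lambda>_. x)"
    using Suc.prems(5) by (intro liftsI[of U "\<lambda>_. y"]) (auto simp: algebra_simps)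
  from lifts_apply[OF _ lifts_Volterra[OF _ this]] Suc.prems mu
  have "lifts (J s) (U \<times> {0..1}) (\<lambda>(e, t). A e t (Volterra (A e) n t x))"
    by simp
  then have "lifts (J s) {0..b} (\<lambda>t. A e t (Volterra (A e) n t x))"
    using lifts_compose[of "J s" "U \<times> {0..1}" "\<lambda>(e, t). A e t (Volterra (A e) n t x)" "{0..b}" "\<lambda>t. (e, t)",
        OF _ continuous_on_Pair[OF continuous_on_const continuous_on_id]] Suc.prems(3,4)
    by (simp add: image_subset_iff)
  then obtain w where w: "continuous_on {0..b} w"
    "\<And>t. t \<in> {0..b} \<Longrightarrow> A e t (Volterra (A e) n t x) = J s (w t)"
    unfolding lifts_def by blast
  have iw: "w integrable_on {0..b}"
    using w(1) by (rule integrable_continuous_real)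
  have "simplex_integral (Suc n) b (\<lambda>ts. C (foldr (A e) ts x)) =
        integral {0..b} (\<lambda>t. simplex_integral n t (\<lambda>ts. C (A e t (foldr (A e) ts x))))"
    by simp
  also have "\<dots> = integral {0..b} (\<lambda>t. C (J s (w t)))"
    using Suc.prems(4) by (intro integral_cong) (simp add: IH w)
  also have "\<dots> = C (J s (integral {0..b} w))"
    using integral_linear[OF iw Suc.prems(2)] by (simp add: o_def)
  also have "J s (integral {0..b} w) = integral {0..b} (\<lambda>t. J s (w t))"
    using integral_linear[OF iw J_bounded_linear[OF Suc.prems(1)]] by (simp add: o_def)
  also have "\<dots> = integral {0..b} (\<lambda>t. A e t (Volterra (A e) n t x))"
    by (intro integral_cong) (simp add: w)
  finally show ?case by simp
qed simp

lemma lifts_Dyson: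
  assumes s: "s \<ge> 0" and x: "lifts (J (s + real n * \<mu>)) U x"
  shows "lifts (J s) U (\<lambda>e. Dyson (A e) n (x e))"
proof (rule lifts_cong)
  show "lifts (J s) U (\<lambda>e. Volterra (A e) n 1 (x e))"
    using lifts_compose[OF lifts_Volterra[OF s x], of U "\<lambda>e. (e, 1)",
        OF continuous_on_Pair[OF continuous_on_id continuous_on_const]]
    by (simp add: image_subset_iff)
  show "Volterra (A e) n 1 (x e) = Dyson (A e) n (x e)" if "e \<in> U" for e
  proof -
    from x that obtain y where "x e = J (s + real n * \<mu>) y"
      unfolding lifts_def by blast
    from simplex_integral_Volterra[where C = "\<lambda>x. x", OF s J_bounded_linear[OF s] that _ this, of 1]
    show ?thesis by (simp add: Dyson_def)
  qed
qed

text \<open>The head of the list acts last, so the remaining factors must land in level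
  \<open>s + real n * \<mu>\<close>; the losses of all factors add up.\<close>

lemma lifts_foldr_Dyson:
  assumes "s \<ge> 0" "lifts (J (s + real (sum_list ns) * \<mu>)) U x"
  shows "lifts (J s) U (\<lambda>e. foldr (Dyson (A e)) ns (x e))"
  using assms
proof (induction ns arbitrary: s)
  case (Cons n ns)
  have "lifts (J (s + real n * \<mu>)) U (\<lambda>e. foldr (Dyson (A e)) ns (x e))"
    using Cons.prems mu by (intro Cons.IH) (auto simp: algebra_simps)
  from lifts_Dyson[OF Cons.prems(1) this] show ?case by simp
qed simp

text \<open>Every composition has entries summing to \<open>l + 1\<close>, so all products in the
  coefficient lose the same amount of regularity.\<close>

lemma lifts_FM:
  assumes s: "s \<ge> 0" and x: "lifts (J (s + real (l + 1) * \<mu>)) U x"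
  shows "lifts (J s) U (\<lambda>e. FM l (A e) (x e))"
  unfolding FM_def
  by (intro lifts_scaleC[where j = "J s", OF J_scaleC[OF s]] lifts_sum[OF J_bounded_linear[OF s]]
        lifts_foldr_Dyson[OF s])
     (use x in \<open>auto simp: compositions_def\<close>)

lemma lifts_FM_eff:
  assumes s: "s \<ge> 0" and x: "\<And>l. l \<le> L \<Longrightarrow> lifts (J (s + real (l + 1) * \<mu>)) U x"
  shows "lifts (J s) U (\<lambda>e. FM_eff T L (A e) (x e))"
  unfolding FM_eff_def scaleC_of_real[symmetric]
  by (intro lifts_sum[OF J_bounded_linear[OF s]] lifts_scaleC[where j = "J s", OF J_scaleC[OF s]]
        lifts_FM[OF s] x) simp

end

section \<open>Spectral decomposition of an operator with compact resolvent\<close>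

lemma csubspace_imp_subspace: "csubspace M \<Longrightarrow> subspace M"
  unfolding csubspace_def subspace_def scaleC_of_real[symmetric] by blast

text \<open>The imaginary part of \<open>cinner m x\<close> is the real inner product of
  \<open>\<i> *\<^sub>C m\<close> with \<open>x\<close>, and a complex subspace contains that
  vector. Hence the real projection theorem suffices.\<close>

lemma cinner_eq_0_iff_on_csubspace:
  assumes "csubspace M"
  shows "(\<forall>m\<in>M. cinner m x = 0) \<longleftrightarrow> (\<forall>m\<in>M. inner m x = 0)"
proof
  assume *: "\<forall>m\<in>M. inner m x = 0"
  show "\<forall>m\<in>M. cinner m x = 0"
  proof
    fix m assume m: "m \<in> M"
    then have "\<i> *\<^sub>C m \<in> M"
      using assms by (simp add: csubspace_def)
    have "cinner (\<i> *\<^sub>C m) x = - \<i> * cinner m x"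
      using cinner_commute[of "\<i> *\<^sub>C m" x] cinner_commute[of m x] by (simp add: cinner_scaleC_right)
    then have "Im (cinner m x) = inner (\<i> *\<^sub>C m) x"
      by (simp add: Re_cinner[symmetric])
    with * m \<open>\<i> *\<^sub>C m \<in> M\<close> show "cinner m x = 0"
      by (intro complex_eqI) (simp_all add: Re_cinner)
  qed
qed (simp add: Re_cinner[symmetric])

context
  fixes M :: "'a::complex_hilbert set"
  assumes M: "csubspace M" "closed M"
begin

text \<open>The difference of two candidates lies in \<open>M\<close> and is orthogonal to itself.
  This makes the definite description in \<open>orth_proj\<close> meaningful.\<close>

lemma orth_proj_unique:
  assumes "p \<in> M" "\<And>m. m \<in> M \<Longrightarrow> inner m (x - p) = 0"
  shows "orth_proj M x = p"
  unfolding orth_proj_def cinner_eq_0_iff_on_csubspace[OF M(1)]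
proof (rule the_equality)
  fix q assume q: "q \<in> M \<and> (\<forall>m\<in>M. inner m (x - q) = 0)"
  have "p - q \<in> M"
    using q assms csubspace_imp_subspace[OF M(1)] by (simp add: subspace_diff)
  with q assms have "inner (p - q) (x - q) - inner (p - q) (x - p) = 0"
    by simp
  then have "inner (p - q) (p - q) = 0"
    by (simp add: inner_diff_right)
  then show "q = p" by simp
qed (use assms in simp)

lemma orth_proj_mem: "orth_proj M x \<in> M"
  and orth_proj_orthogonal: "m \<in> M \<Longrightarrow> inner m (x - orth_proj M x) = 0"
  using ex_orthogonal_projection[OF csubspace_imp_subspace[OF M(1)] M(2), of x] orth_proj_unique[of _ x]
  by metis+

lemma orth_proj_ident: "x \<in> M \<Longrightarrow> orth_proj M x = x"
  by (rule orth_proj_unique) auto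

lemma inner_orth_proj: "inner x (orth_proj M x) = (norm (orth_proj M x))\<^sup>2"
  using orth_proj_orthogonal[OF orth_proj_mem, of x x]
  by (simp add: inner_diff_right power2_norm_eq_inner inner_commute)

lemma orth_proj_add: "orth_proj M (x + y) = orth_proj M x + orth_proj M y"
proof (rule orth_proj_unique)
  show "orth_proj M x + orth_proj M y \<in> M"
    using orth_proj_mem M(1) by (simp add: csubspace_def)
  show "inner m (x + y - (orth_proj M x + orth_proj M y)) = 0" if "m \<in> M" for m
    using orth_proj_orthogonal[OF that, of x] orth_proj_orthogonal[OF that, of y]
    by (simp add: inner_simps)
qed

lemma orth_proj_scaleC: "orth_proj M (c *\<^sub>C x) = c *\<^sub>C orth_proj M x"
proof (rule orth_proj_unique)
  show "c *\<^sub>C orth_proj M x \<in> M"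
    using orth_proj_mem M(1) by (simp add: csubspace_def)
  have "\<forall>m\<in>M. cinner m (x - orth_proj M x) = 0"
    using orth_proj_orthogonal by (simp add: cinner_eq_0_iff_on_csubspace[OF M(1)])
  then have "\<forall>m\<in>M. cinner m (c *\<^sub>C x - c *\<^sub>C orth_proj M x) = 0"
    by (simp add: cinner_scaleC_right
        flip: linear_diff[OF bounded_linear.linear[OF bounded_linear_scaleC]])
  then show "inner m (c *\<^sub>C x - c *\<^sub>C orth_proj M x) = 0" if "m \<in> M" for m
    using that by (simp add: cinner_eq_0_iff_on_csubspace[OF M(1)])
qed

lemma norm_orth_proj_le: "norm (orth_proj M x) \<le> norm x"
proof (cases "orth_proj M x = 0")
  case False
  have "(norm (orth_proj M x))\<^sup>2 \<le> norm x * norm (orth_proj M x)"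
    using norm_cauchy_schwarz[of x "orth_proj M x"] by (simp add: inner_orth_proj)
  then show ?thesis
    using False by (simp add: power2_eq_square)
qed simp

lemma bounded_linear_orth_proj: "bounded_linear (orth_proj M)"
  by (rule bounded_linear_intro[where K = 1])
     (simp_all add: orth_proj_add norm_orth_proj_le orth_proj_scaleC flip: scaleC_of_real)

end

section \<open>The resolvent at -1 and completeness of the eigenspaces\<close>

locale positive_compact_resolvent =
  fixes D0 :: "'a::complex_hilbert set" and H0 :: "'a \<Rightarrow> 'a"
  assumes pos: "positive_self_adjoint D0 H0" and cr: "compact_resolvent D0 H0"
begin

abbreviation "Ev \<equiv> eigenvalues D0 H0"
abbreviation "E \<equiv> eigenspace D0 H0"
abbreviation "P l \<equiv> orth_proj (E l)"
abbreviation "fc \<equiv> fun_calc D0 H0"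
text \<open>Since -1 lies outside the nonnegative spectrum, this is the inverse of
  \<open>1 + H0\<close>: a bounded symmetric operator to which the compact spectral argument
  applies.\<close>

abbreviation "K \<equiv> resolvent D0 H0 (- 1)"

lemma csubspace_D0: "csubspace D0"
  and H0_add: "x \<in> D0 \<Longrightarrow> y \<in> D0 \<Longrightarrow> H0 (x + y) = H0 x + H0 y"
  and H0_scaleC: "x \<in> D0 \<Longrightarrow> H0 (c *\<^sub>C x) = c *\<^sub>C H0 x"
  using pos by (auto simp: positive_self_adjoint_def self_adjoint_def densely_defined_def clinear_on_def)

lemma H0_scaleR: "x \<in> D0 \<Longrightarrow> H0 (a *\<^sub>R x) = a *\<^sub>R H0 x"
  using H0_scaleC[of x "of_real a"] by (simp add: scaleC_of_real)

lemma H0_symmetric: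
  assumes "x \<in> D0" "y \<in> D0"
  shows "inner (H0 x) y = inner x (H0 y)"
proof -
  have "(y, H0 y) \<in> adjoint_graph D0 H0"
    using pos assms by (auto simp: positive_self_adjoint_def self_adjoint_def op_graph_def)
  then have "cinner (H0 x) y = cinner x (H0 y)"
    using assms by (simp add: adjoint_graph_def)
  then show ?thesis by (metis Re_cinner)
qed

text \<open>An eigenvector and \<open>0\<close> have the same image under \<open>H0 - l\<close>, so
  injectivity fails and \<open>l\<close> belongs to the spectrum.\<close>

lemma eigenvalue_nonneg:
  assumes "l \<in> Ev"
  shows "l \<ge> 0"
proof -
  from assms obtain x where x: "x \<in> D0" "H0 x = l *\<^sub>R x" "x \<noteq> 0"
    by (auto simp: eigenvalues_def eigenspace_def)
  have "(0::'a) \<in> D0"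
    using csubspace_D0 by (simp add: csubspace_def)
  moreover have "H0 0 = 0"
    using H0_scaleR[OF \<open>0 \<in> D0\<close>, of 0] by simp
  ultimately have "\<not> inj_on (\<lambda>x. H0 x - complex_of_real l *\<^sub>C x) D0"
    using x unfolding inj_on_def scaleC_of_real
    by (intro notI) (drule bspec[OF _ x(1)], drule bspec[where x = 0], auto)
  then have "complex_of_real l \<in> spectrum D0 H0"
    by (auto simp: spectrum_def resolvent_set_def bij_betw_def)
  with pos show ?thesis
    by (auto simp: positive_self_adjoint_def)
qed

lemma minus_one_in_resolvent_set: "- 1 \<in> resolvent_set D0 H0"
proof (rule ccontr)
  assume "- 1 \<notin> resolvent_set D0 H0"
  then have "- 1 \<in> spectrum D0 H0" by (simp add: spectrum_def)
  then obtain a where a: "a \<ge> 0" "- 1 = complex_of_real a"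
    using pos by (auto simp: positive_self_adjoint_def)
  from a(2) have "Re (- 1) = a" by simp
  with a(1) show False by simp
qed

lemma resolvent_right_inverse:
  assumes "z \<in> resolvent_set D0 H0"
  shows "resolvent D0 H0 z x \<in> D0" "H0 (resolvent D0 H0 z x) - z *\<^sub>C resolvent D0 H0 z x = x"
  using assms f_inv_into_f[of x "\<lambda>x. H0 x - z *\<^sub>C x" D0] inv_into_into[of x "\<lambda>x. H0 x - z *\<^sub>C x" D0]
  by (auto simp: resolvent_set_def bij_betw_def resolvent_def)

lemma resolvent_left_inverse:
  assumes "z \<in> resolvent_set D0 H0" "x \<in> D0"
  shows "resolvent D0 H0 z (H0 x - z *\<^sub>C x) = x"
  using assms inv_into_f_f[of "\<lambda>x. H0 x - z *\<^sub>C x" D0 x]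
  by (auto simp: resolvent_set_def bij_betw_def resolvent_def)

lemma minus_one_scaleC: "(- 1) *\<^sub>C x = - (x::'a)"
  using scaleC_of_real[of "- 1" x] by simp

lemma bounded_linear_K: "bounded_linear K"
  using minus_one_in_resolvent_set by (simp add: resolvent_set_def)

lemma K_mem: "K x \<in> D0"
  by (rule resolvent_right_inverse[OF minus_one_in_resolvent_set])

lemma H0_K: "H0 (K x) + K x = x"
  using resolvent_right_inverse(2)[OF minus_one_in_resolvent_set, of x] by (simp add: minus_one_scaleC)

lemma K_H0: "x \<in> D0 \<Longrightarrow> K (H0 x + x) = x"
  using resolvent_left_inverse[OF minus_one_in_resolvent_set, of x] by (simp add: minus_one_scaleC)

lemma K_symmetric: "inner (K x) y = inner x (K y)"
proof -
  have "inner (K x) y = inner (K x) (H0 (K y) + K y)"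
    by (simp add: H0_K)
  also have "\<dots> = inner (H0 (K x) + K x) (K y)"
    by (simp add: inner_simps H0_symmetric K_mem)
  finally show ?thesis by (simp add: H0_K)
qed

text \<open>Compactness is given at some unspecified \<open>z\<close>. The resolvent identity writes
  \<open>K\<close> as the resolvent at \<open>z\<close> after the bounded map \<open>Y\<close>,
  which transfers it to -1.\<close>

lemma compact_K:
  fixes X :: "nat \<Rightarrow> 'a"
  assumes "bounded (range X)"
  shows "\<exists>\<sigma> v. strict_mono \<sigma> \<and> (\<lambda>n. K (X (\<sigma> n))) \<longlonglongrightarrow> v"
proof -
  obtain z where z: "z \<in> resolvent_set D0 H0" "compact_op (resolvent D0 H0 z)"
    using cr by (auto simp: compact_resolvent_def)
  define Y where "Y x = x - (1 + z) *\<^sub>C K x" for x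
  have RY: "resolvent D0 H0 z (Y x) = K x" for x
  proof -
    have "Y x = (H0 (K x) + K x) - (1 + z) *\<^sub>C K x"
      by (simp add: Y_def H0_K)
    also have "\<dots> = H0 (K x) - z *\<^sub>C K x"
      by (simp add: scaleC_add_left)
    finally show ?thesis
      using resolvent_left_inverse[OF z(1) K_mem] by simp
  qed
  have "bounded_linear Y"
    unfolding Y_def[abs_def]
    by (intro bounded_linear_sub bounded_linear_ident
        bounded_linear_compose[OF bounded_linear_scaleC bounded_linear_K])
  then have "bounded (Y ` range X)"
    using assms by (intro bounded_linear_image)
  then have "compact (closure (resolvent D0 H0 z ` Y ` range X))"
    using z(2) by (simp add: compact_op_def)
  then have "compact (closure (range (\<lambda>n. K (X n))))"
    by (simp add: image_image RY)
  moreover have "K (X n) \<in> closure (range (\<lambda>n. K (X n)))" for n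
    by (rule subsetD[OF closure_subset]) simp
  ultimately have "\<exists>v\<in>closure (range (\<lambda>n. K (X n))). \<exists>\<sigma>. strict_mono \<sigma> \<and> ((\<lambda>n. K (X n)) \<circ> \<sigma>) \<longlonglongrightarrow> v"
    unfolding compact_def by (elim allE[of _ "\<lambda>n. K (X n)"] mp) simp
  then show ?thesis
    unfolding o_def by (elim bexE exE) (intro exI)
qed

lemma csubspace_E: "csubspace (E l)"
proof -
  have "H0 0 = 0"
    using csubspace_D0 H0_scaleR[of 0 0] by (simp add: csubspace_def)
  then show ?thesis
    using csubspace_D0
    by (simp add: csubspace_def eigenspace_def H0_add H0_scaleC scaleC_scaleR scaleR_add_right)
qed

text \<open>Describing eigenspaces of the unbounded \<open>H0\<close> through the bounded
  \<open>K\<close> makes them visibly closed and shows that \<open>K\<close> acts on them by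
  scalars.\<close>

lemma eigenspace_eq:
  assumes "l \<ge> 0"
  shows "E l = {x. K x = inverse (1 + l) *\<^sub>R x}"
proof (rule set_eqI, unfold mem_Collect_eq, rule iffI)
  interpret K: bounded_linear K by (rule bounded_linear_K)
  fix x
  {
    assume "x \<in> E l"
    then have "K ((1 + l) *\<^sub>R x) = x"
      using K_H0[of x] by (simp add: eigenspace_def scaleR_add_left add.commute)
    then have "inverse (1 + l) *\<^sub>R ((1 + l) *\<^sub>R K x) = inverse (1 + l) *\<^sub>R x"
      by (simp add: K.scaleR)
    then show "K x = inverse (1 + l) *\<^sub>R x"
      using assms by simp
  }
  assume Kx: "K x = inverse (1 + l) *\<^sub>R x"
  then have x: "x = (1 + l) *\<^sub>R K x"
    using assms by simp
  have "x \<in> D0"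
    using subspace_scale[OF csubspace_imp_subspace[OF csubspace_D0] K_mem] x by metis
  moreover have "H0 x = l *\<^sub>R x"
  proof -
    have "H0 x = (1 + l) *\<^sub>R H0 (K x)"
      using H0_scaleR[OF K_mem] x by metis
    also have "H0 (K x) = x - K x"
      using H0_K[of x] by (simp add: algebra_simps)
    also have "(1 + l) *\<^sub>R (x - K x) = (1 + l) *\<^sub>R x - x"
      unfolding scaleR_diff_right x[symmetric] ..
    finally show ?thesis by (simp add: scaleR_add_left)
  qed
  ultimately show "x \<in> E l"
    by (simp add: eigenspace_def)
qed

lemma closed_E:
  assumes "l \<in> Ev"
  shows "closed (E l)"
  unfolding eigenspace_eq[OF eigenvalue_nonneg[OF assms]]
  by (intro closed_Collect_eq continuous_intros bounded_linear.continuous_on[OF bounded_linear_K])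

lemmas P_mem = orth_proj_mem[OF csubspace_E closed_E]
  and P_orthogonal = orth_proj_orthogonal[OF csubspace_E closed_E]
  and P_ident = orth_proj_ident[OF csubspace_E closed_E]
  and P_unique = orth_proj_unique[OF csubspace_E closed_E]
  and P_add = orth_proj_add[OF csubspace_E closed_E]
  and P_scaleC = orth_proj_scaleC[OF csubspace_E closed_E]
  and bounded_linear_P = bounded_linear_orth_proj[OF csubspace_E closed_E]
  and inner_P = inner_orth_proj[OF csubspace_E closed_E]

lemma eigenspaces_orthogonal:
  assumes "x \<in> E l" "y \<in> E \<nu>" "l \<noteq> \<nu>"
  shows "inner x y = 0"
proof -
  have "l * inner x y = \<nu> * inner x y"
    using assms H0_symmetric[of x y] by (simp add: eigenspace_def)
  with assms show ?thesis by simp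
qed

lemma pairwise_orthogonal:
  "(\<And>l. l \<in> Ev \<Longrightarrow> v l \<in> E l) \<Longrightarrow> pairwise (\<lambda>i j. orthogonal (v i) (v j)) Ev"
  by (auto simp: pairwise_def orthogonal_def intro: eigenspaces_orthogonal)

lemma P_other: "x \<in> E \<nu> \<Longrightarrow> l \<in> Ev \<Longrightarrow> l \<noteq> \<nu> \<Longrightarrow> P l x = 0"
  using csubspace_E
  by (intro P_unique) (auto simp: csubspace_def intro: eigenspaces_orthogonal)

text \<open>The continuous projection \<open>P \<nu>\<close> may be applied termwise, and
  orthogonality of the eigenspaces leaves a single term.\<close>

lemma P_has_sum:
  assumes "\<And>l. l \<in> Ev \<Longrightarrow> v l \<in> E l" "(v has_sum s) Ev" "\<nu> \<in> Ev"
  shows "P \<nu> s = v \<nu>"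
proof (rule has_sum_unique)
  show "((\<lambda>l. P \<nu> (v l)) has_sum P \<nu> s) Ev"
    by (rule has_sum_bounded_linear[OF bounded_linear_P[OF assms(3)] assms(2)])
  show "((\<lambda>l. P \<nu> (v l)) has_sum v \<nu>) Ev"
    using assms P_other P_ident by (intro has_sum_finite_neutralI[of "{\<nu>}"]) auto
qed

text \<open>Bessel's inequality: for a finite sum \<open>s\<close> of projections, the squared norm
  of \<open>s\<close> equals \<open>inner x s\<close>, and Cauchy-Schwarz gives a bound independent
  of the finite set.\<close>

lemma P_square_summable: "(\<lambda>l. (norm (P l x))\<^sup>2) summable_on Ev"
proof (rule nonneg_bdd_above_summable_on)
  show "bdd_above (sum (\<lambda>l. (norm (P l x))\<^sup>2) ` {F. F \<subseteq> Ev \<and> finite F})"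
  proof (rule bdd_aboveI2)
    fix F assume F: "F \<in> {F. F \<subseteq> Ev \<and> finite F}"
    define s where "s = (\<Sum>l\<in>F. P l x)"
    have s: "(norm s)\<^sup>2 = (\<Sum>l\<in>F. (norm (P l x))\<^sup>2)"
      unfolding s_def using F pairwise_orthogonal[of "\<lambda>l. P l x"] P_mem
      by (intro norm_sum_Pythagorean) (auto intro: pairwise_subset)
    also have "\<dots> = inner x s"
      unfolding s_def inner_sum_right using F by (intro sum.cong) (auto simp: inner_P)
    also have "\<dots> \<le> norm x * norm s"
      by (rule norm_cauchy_schwarz)
    finally have "norm s \<le> norm x"
      by (cases "s = 0") (auto simp: power2_eq_square)
    then show "(\<Sum>l\<in>F. (norm (P l x))\<^sup>2) \<le> (norm x)\<^sup>2"
      unfolding s[symmetric] by (rule power_mono) simp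
  qed
qed simp

text \<open>The orthogonal complement of all eigenspaces is closed and invariant under the symmetric
  \<open>K\<close>. If it were nonzero, it would contain an eigenvector of \<open>K\<close>, hence
  one of \<open>H0\<close>, which would be orthogonal to itself.\<close>

lemma orthogonal_to_eigenspaces_imp_0:
  assumes "\<And>l m. l \<in> Ev \<Longrightarrow> m \<in> E l \<Longrightarrow> inner m y = 0"
  shows "y = 0"
proof (rule ccontr)
  assume "y \<noteq> 0"
  interpret K: bounded_linear K by (rule bounded_linear_K)
  define M where "M = (\<Inter>m\<in>(\<Union>l\<in>Ev. E l). {x. inner m x = 0})"
  have "subspace M"
    by (auto simp: M_def subspace_def inner_simps)
  moreover have "closed M"
    unfolding M_def by (intro closed_INT ballI closed_Collect_eq continuous_intros)
  moreover have "K ` M \<subseteq> M"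
  proof safe
    fix x assume "x \<in> M"
    then show "K x \<in> M"
      by (auto simp: M_def K_symmetric[symmetric] eigenspace_eq eigenvalue_nonneg)
  qed
  moreover have "y \<in> M"
    using assms by (auto simp: M_def)
  \<comment> \<open>\<open>K\<close> is injective, since \<open>y\<close> is recovered from
    \<open>K y\<close> by \<open>1 + H0\<close>.\<close>
  moreover have "K y \<noteq> 0"
    using H0_K[of y] \<open>y \<noteq> 0\<close> csubspace_D0 H0_scaleR[of 0 0] by (auto simp: csubspace_def)
  ultimately obtain x \<kappa> where x: "x \<in> M" "x \<noteq> 0" "\<kappa> \<noteq> 0" "K x = \<kappa> *\<^sub>R x"
    using compact_symmetric_ex_eigenvector[OF bounded_linear_K K_symmetric compact_K, of M] by blast
  have xK: "x = (1 / \<kappa>) *\<^sub>R K x"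
    using x by simp
  have "x \<in> D0"
    using subspace_scale[OF csubspace_imp_subspace[OF csubspace_D0] K_mem] xK by metis
  moreover have "H0 x = (1 / \<kappa> - 1) *\<^sub>R x"
  proof -
    have "H0 x = (1 / \<kappa>) *\<^sub>R H0 (K x)"
      using H0_scaleR[OF K_mem] xK by metis
    also have "H0 (K x) = x - K x"
      using H0_K[of x] by (simp add: algebra_simps)
    finally show ?thesis
      using x by (simp add: scaleR_diff_right scaleR_diff_left)
  qed
  ultimately have "x \<in> E (1 / \<kappa> - 1)"
    by (simp add: eigenspace_def)
  moreover from this x have "1 / \<kappa> - 1 \<in> Ev"
    by (auto simp: eigenvalues_def)
  ultimately have "inner x x = 0"
    using x(1) by (auto simp: M_def)
  with x show False by simp
qed

text \<open>Bessel gives convergence to some \<open>s\<close>; the remainder \<open>x - s\<close>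
  has no component in any eigenspace and so vanishes by completeness.\<close>

lemma eigenvector_expansion: "((\<lambda>l. P l x) has_sum x) Ev"
proof -
  have "(\<lambda>l. P l x) summable_on Ev"
    by (rule orthogonal_summable_on[OF pairwise_orthogonal P_square_summable]) (rule P_mem)
  then obtain s where s: "((\<lambda>l. P l x) has_sum s) Ev"
    by (auto simp: summable_on_def)
  have "x - s = 0"
  proof (rule orthogonal_to_eigenspaces_imp_0)
    fix l m assume m: "l \<in> Ev" "m \<in> E l"
    have "P l s = P l x"
      using P_mem by (intro P_has_sum[OF _ s] m) auto
    then show "inner m (x - s) = 0"
      using P_orthogonal[OF m, of x] P_orthogonal[OF m, of s] by (simp add: inner_diff_right)
  qed
  with s show ?thesis by simp
qed

lemma norm_expansion: "((\<lambda>l. (norm (P l x))\<^sup>2) has_sum (norm x)\<^sup>2) Ev"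
  by (rule has_sum_orthogonal_norm[OF pairwise_orthogonal eigenvector_expansion]) (rule P_mem)

section \<open>Functional calculus in the eigenvector expansion\<close>

lemma fun_calc_dom_bounded:
  assumes "\<And>l. l \<in> Ev \<Longrightarrow> \<bar>f l\<bar> \<le> C"
  shows "x \<in> fun_calc_dom D0 H0 f"
  unfolding fun_calc_dom_def mem_Collect_eq
proof (rule summable_on_comparison_test)
  show "(\<lambda>l. C\<^sup>2 * (norm (P l x))\<^sup>2) summable_on Ev"
    by (intro summable_on_cmult_right P_square_summable)
  show "(f l)\<^sup>2 * (norm (P l x))\<^sup>2 \<le> C\<^sup>2 * (norm (P l x))\<^sup>2" if "l \<in> Ev" for l
    using power_mono[OF assms[OF that], of 2] by (intro mult_right_mono) auto
qed simp

lemma scaleR_P_mem: "l \<in> Ev \<Longrightarrow> a *\<^sub>R P l x \<in> E l"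
  by (intro subspace_scale csubspace_imp_subspace csubspace_E P_mem)

lemma fun_calc_has_sum:
  assumes "x \<in> fun_calc_dom D0 H0 f"
  shows "((\<lambda>l. f l *\<^sub>R P l x) has_sum fc f x) Ev"
  unfolding fun_calc_def
proof (rule has_sum_infsum, rule orthogonal_summable_on[OF pairwise_orthogonal])
  show "f l *\<^sub>R P l x \<in> E l" if "l \<in> Ev" for l
    using that by (rule scaleR_P_mem)
  show "(\<lambda>l. (norm (f l *\<^sub>R P l x))\<^sup>2) summable_on Ev"
    using assms by (simp add: fun_calc_dom_def power_mult_distrib)
qed

lemma P_fun_calc:
  assumes "x \<in> fun_calc_dom D0 H0 f" "l \<in> Ev"
  shows "P l (fc f x) = f l *\<^sub>R P l x"
  by (rule P_has_sum[OF _ fun_calc_has_sum[OF assms(1)] assms(2)]) (rule scaleR_P_mem)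

lemma fun_calc_cong: "(\<And>l. l \<in> Ev \<Longrightarrow> f l = g l) \<Longrightarrow> fc f x = fc g x"
  unfolding fun_calc_def by (intro infsum_cong) simp

text \<open>The components of \<open>fc g x\<close> are known, so the two infinite sums agree term
  by term, whether or not they converge.\<close>

lemma fun_calc_fun_calc:
  assumes "x \<in> fun_calc_dom D0 H0 g"
  shows "fc f (fc g x) = fc (\<lambda>l. f l * g l) x"
  unfolding fun_calc_def[of D0 H0 f] fun_calc_def[of D0 H0 "\<lambda>l. f l * g l"]
  by (intro infsum_cong) (simp add: P_fun_calc[OF assms])

lemma fun_calc_one: "(\<And>l. l \<in> Ev \<Longrightarrow> f l = 1) \<Longrightarrow> fc f x = x"
  using infsumI[OF eigenvector_expansion, of x] fun_calc_cong[of f "\<lambda>_. 1" x]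
  by (simp add: fun_calc_def)

lemma norm_fun_calc_le:
  assumes "\<And>l. l \<in> Ev \<Longrightarrow> \<bar>f l\<bar> \<le> C" "C \<ge> 0"
  shows "norm (fc f x) \<le> C * norm x"
proof -
  have "((\<lambda>l. (norm (f l *\<^sub>R P l x))\<^sup>2) has_sum (norm (fc f x))\<^sup>2) Ev"
    by (rule has_sum_orthogonal_norm[OF pairwise_orthogonal
          fun_calc_has_sum[OF fun_calc_dom_bounded[OF assms(1)]]]) (rule scaleR_P_mem)
  moreover have "((\<lambda>l. C\<^sup>2 * (norm (P l x))\<^sup>2) has_sum C\<^sup>2 * (norm x)\<^sup>2) Ev"
    by (intro has_sum_cmult_right norm_expansion)
  ultimately have "(norm (fc f x))\<^sup>2 \<le> C\<^sup>2 * (norm x)\<^sup>2"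
  proof (rule has_sum_mono)
    fix l assume "l \<in> Ev"
    then show "(norm (f l *\<^sub>R P l x))\<^sup>2 \<le> C\<^sup>2 * (norm (P l x))\<^sup>2"
      using power_mono[OF assms(1), of l 2] by (simp add: power_mult_distrib mult_right_mono)
  qed
  then show ?thesis
    using assms(2) by (intro power2_le_imp_le[of "norm (fc f x)"]) (auto simp: power_mult_distrib)
qed

lemma fun_calc_bounded_linear:
  assumes "\<And>l. l \<in> Ev \<Longrightarrow> \<bar>f l\<bar> \<le> C" "C \<ge> 0"
  shows "bounded_linear (fc f)" and "fc f (c *\<^sub>C x) = c *\<^sub>C fc f x"
proof -
  note hs = fun_calc_has_sum[OF fun_calc_dom_bounded[OF assms(1)]]
  have scaleC: "fc f (c *\<^sub>C x) = c *\<^sub>C fc f x" for c x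
  proof (rule has_sum_unique[OF hs])
    have "((\<lambda>l. c *\<^sub>C (f l *\<^sub>R P l x)) has_sum c *\<^sub>C fc f x) Ev"
      by (rule has_sum_bounded_linear[OF bounded_linear_scaleC hs])
    then show "((\<lambda>l. f l *\<^sub>R P l (c *\<^sub>C x)) has_sum c *\<^sub>C fc f x) Ev"
      by (rule has_sum_cong[THEN iffD1, rotated]) (simp add: scaleC_scaleR P_scaleC)
  qed
  then show "fc f (c *\<^sub>C x) = c *\<^sub>C fc f x" .
  have add: "fc f (x + y) = fc f x + fc f y" for x y
  proof (rule has_sum_unique[OF hs])
    have "((\<lambda>l. f l *\<^sub>R P l x + f l *\<^sub>R P l y) has_sum fc f x + fc f y) Ev"
      by (intro has_sum_add hs)
    then show "((\<lambda>l. f l *\<^sub>R P l (x + y)) has_sum fc f x + fc f y) Ev"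
      by (rule has_sum_cong[THEN iffD1, rotated]) (simp add: scaleR_add_right P_add)
  qed
  show "bounded_linear (fc f)"
  proof (rule bounded_linear_intro[where K = C])
    show "fc f (a *\<^sub>R x) = a *\<^sub>R fc f x" for a x
      using scaleC[of "of_real a" x] by (simp add: scaleC_of_real)
    show "norm (fc f x) \<le> norm x * C" for x
      using norm_fun_calc_le[OF assms, where x = x] by (simp add: mult.commute)
  qed (rule add)
qed

end

section \<open>Convergence of the truncations\<close>

text \<open>In the order topology \<open>enat\<close> is a convergent sequence with its limit:
  finite points are isolated, and neighbourhoods of \<infinity> contain a tail.\<close>

lemma continuous_on_UNIV_enat_iff:
  fixes f :: "enat \<Rightarrow> 'a::topological_space"
  shows "continuous_on UNIV f \<longleftrightarrow> (\<lambda>n. f (enat n)) \<longlonglongrightarrow> f \<infinity>"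
proof
  assume f: "continuous_on UNIV f"
  show "(\<lambda>n. f (enat n)) \<longlonglongrightarrow> f \<infinity>"
  proof (rule topological_tendstoI)
    fix B assume "open B" "f \<infinity> \<in> B"
    with f have "open (f -` B)" "\<infinity> \<in> f -` B"
      by (auto simp: continuous_on_open_vimage)
    then obtain n :: nat where "{enat n<..} \<subseteq> f -` B"
      by (auto simp: open_enat_iff)
    then have "f (enat m) \<in> B" if "m \<ge> Suc n" for m
      using that by (auto simp: subset_eq)
    then show "\<forall>\<^sub>F n in sequentially. f (enat n) \<in> B"
      unfolding eventually_sequentially by blast
  qed
next
  assume lim: "(\<lambda>n. f (enat n)) \<longlonglongrightarrow> f \<infinity>"
  have "open (f -` B)" if "open B" for B
    unfolding open_enat_iff
  proof
    assume "\<infinity> \<in> f -` B"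
    with topological_tendstoD[OF lim that] obtain N where N: "\<And>n. n \<ge> N \<Longrightarrow> f (enat n) \<in> B"
      by (auto simp: eventually_sequentially)
    have "f e \<in> B" if "e > enat N" for e
      using that N \<open>\<infinity> \<in> f -` B\<close> by (cases e) auto
    then show "\<exists>n::nat. {enat n<..} \<subseteq> f -` B" by auto
  qed
  then show "continuous_on UNIV f"
    by (simp add: continuous_on_open_vimage)
qed

text \<open>Strong continuity becomes joint continuity: the change of the vector is controlled by
  the uniform bound 1, the change of the operator by its values on one fixed vector.\<close>

lemma continuous_on_contractions:
  fixes Q :: "'p::topological_space \<Rightarrow> 'a::real_normed_vector \<Rightarrow> 'a"
  assumes lin: "\<And>e. e \<in> U \<Longrightarrow> bounded_linear (Q e)" and contr: "\<And>e x. e \<in> U \<Longrightarrow> norm (Q e x) \<le> norm x"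
    and cont: "\<And>x. continuous_on U (\<lambda>e. Q e x)"
  shows "continuous_on (U \<times> UNIV) (\<lambda>(e, x). Q e x)"
  unfolding continuous_on_def
proof (rule ballI)
  fix p assume p: "p \<in> U \<times> (UNIV :: 'a set)"
  let ?F = "at p within U \<times> UNIV" and ?q = "\<lambda>q. Q (fst q) (snd p) - Q (fst p) (snd p)"
  have ev: "\<forall>\<^sub>F q in ?F. q \<in> U \<times> UNIV"
    by (simp add: eventually_at_filter)
  have "continuous_on (U \<times> (UNIV :: 'a set)) (\<lambda>q. Q (fst q) (snd p))"
    by (rule continuous_on_compose2[OF cont[of "snd p"]]) (auto intro!: continuous_intros)
  then have "((\<lambda>q. Q (fst q) (snd p)) \<longlongrightarrow> Q (fst p) (snd p)) ?F"
    using p by (auto simp: continuous_on_def)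
  then have "((\<lambda>q. norm (snd q - snd p) + norm (?q q)) \<longlongrightarrow> norm (snd p - snd p) + norm (?q p)) ?F"
    by (intro tendsto_intros)
  then have "((\<lambda>q. norm (snd q - snd p) + norm (?q q)) \<longlongrightarrow> 0) ?F"
    by simp
  then have "((\<lambda>q. Q (fst q) (snd q) - Q (fst p) (snd p)) \<longlongrightarrow> 0) ?F"
  proof (rule Lim_null_comparison[rotated])
    show "\<forall>\<^sub>F q in ?F. norm (Q (fst q) (snd q) - Q (fst p) (snd p)) \<le> norm (snd q - snd p) + norm (?q q)"
      using ev
    proof eventually_elim
      fix q assume q: "q \<in> U \<times> (UNIV :: 'a set)"
      then interpret bounded_linear "Q (fst q)" by (auto intro: lin)
      have "Q (fst q) (snd q) - Q (fst p) (snd p) = Q (fst q) (snd q - snd p) + ?q q"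
        by (simp add: diff)
      then show "norm (Q (fst q) (snd q) - Q (fst p) (snd p)) \<le> norm (snd q - snd p) + norm (?q q)"
        using contr[of "fst q" "snd q - snd p"] q norm_triangle_ineq[of "Q (fst q) (snd q - snd p)" "?q q"]
        by (metis add_right_mono mem_Times_iff order_trans)
    qed
  qed
  then show "((\<lambda>(e, x). Q e x) \<longlongrightarrow> (case p of (e, x) \<Rightarrow> Q e x)) ?F"
    by (simp add: case_prod_unfold LIM_zero_iff)
qed

section \<open>The scale of spaces and the spectral projections\<close>

context positive_compact_resolvent
begin

abbreviation "\<Lambda> s \<equiv> fc (\<lambda>l. (1 + l) powr s)"
definition "J s = \<Lambda> (- s)"
abbreviation "Hs \<equiv> Hscale D0 H0"
abbreviation "PN \<equiv> spec_proj D0 H0"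

lemma powr_minus_le_one: "l \<in> Ev \<Longrightarrow> s \<ge> 0 \<Longrightarrow> \<bar>(1 + l) powr - s\<bar> \<le> 1"
  using eigenvalue_nonneg[of l] ge_one_powr_ge_zero[of "1 + l" s] by (simp add: powr_minus field_simps)

lemma powr_cancel: "l \<in> Ev \<Longrightarrow> (1 + l) powr s * (1 + l) powr - s = 1"
  using eigenvalue_nonneg[of l] by (simp flip: powr_add)

lemma
  assumes "s \<ge> 0"
  shows bounded_linear_J: "bounded_linear (J s)" and J_scaleC: "J s (c *\<^sub>C x) = c *\<^sub>C J s x"
    and J_dom: "x \<in> fun_calc_dom D0 H0 (\<lambda>l. (1 + l) powr - s)"
  using fun_calc_bounded_linear[of "\<lambda>l. (1 + l) powr - s" 1]
    fun_calc_dom_bounded[of "\<lambda>l. (1 + l) powr - s" 1] powr_minus_le_one assms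
  by (auto simp: J_def)

lemma Lam_J: "s \<ge> 0 \<Longrightarrow> \<Lambda> s (J s x) = x"
  by (simp add: J_def fun_calc_fun_calc J_dom fun_calc_one powr_cancel)

lemma J_Lam: "x \<in> Hs s \<Longrightarrow> J s (\<Lambda> s x) = x"
  by (simp add: J_def fun_calc_fun_calc Hscale_def fun_calc_one powr_cancel mult.commute)

lemma J_mem: "s \<ge> 0 \<Longrightarrow> J s x \<in> Hs s"
proof -
  assume s: "s \<ge> 0"
  have "((1 + l) powr s)\<^sup>2 * (norm (P l (J s x)))\<^sup>2 = (norm (P l x))\<^sup>2" if "l \<in> Ev" for l
  proof -
    have "((1 + l) powr s)\<^sup>2 * (norm (P l (J s x)))\<^sup>2 =
        ((1 + l) powr s * (1 + l) powr - s)\<^sup>2 * (norm (P l x))\<^sup>2"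
      using that by (simp add: J_def P_fun_calc J_dom s power_mult_distrib)
    then show ?thesis
      by (simp add: powr_cancel that)
  qed
  then show ?thesis
    using P_square_summable[of x]
    by (simp add: Hscale_def fun_calc_dom_def cong: summable_on_cong)
qed

lemma J_cases:
  assumes "x \<in> Hs s"
  obtains y where "x = J s y"
  using J_Lam[OF assms] by metis

lemma Hnorm_J: "s \<ge> 0 \<Longrightarrow> Hnorm D0 H0 s (J s x) = norm x"
  by (simp add: Hnorm_def Lam_J)

lemma J_add: "s \<ge> 0 \<Longrightarrow> t \<ge> 0 \<Longrightarrow> J (s + t) x = J s (J t x)"
  by (simp add: J_def fun_calc_fun_calc J_dom flip: powr_add)

lemma
  shows bounded_linear_PN: "bounded_linear (PN N)" and norm_PN_le: "norm (PN N x) \<le> norm x"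
    and PN_dom: "x \<in> fun_calc_dom D0 H0 (indicator {0..N})"
  using fun_calc_bounded_linear[of "indicator {0..N}" 1] norm_fun_calc_le[of "indicator {0..N}" 1 x]
    fun_calc_dom_bounded[of "indicator {0..N}" 1]
  by (auto simp: spec_proj_def indicator_def)

lemma PN_J: "s \<ge> 0 \<Longrightarrow> PN N (J s x) = J s (PN N x)"
  by (simp add: J_def spec_proj_def fun_calc_fun_calc J_dom PN_dom mult.commute)

lemma fun_calc_eigenvector:
  assumes "v \<in> E l" "l \<in> Ev"
  shows "fc f v = f l *\<^sub>R v"
  unfolding fun_calc_def
  by (rule infsumI, rule has_sum_finite_neutralI[of "{l}"]) (use assms P_other P_ident in auto)

text \<open>A finite partial sum of the expansion is fixed by \<open>PN N\<close> once
  \<open>N\<close> exceeds the eigenvalues involved; contractivity handles the remainder.\<close>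

lemma tendsto_PN: "((\<lambda>N. PN N x) \<longlongrightarrow> x) at_top"
proof (rule tendstoI)
  fix \<epsilon> :: real assume "\<epsilon> > 0"
  with has_sum_finite_approximation[OF eigenvector_expansion, of "\<epsilon> / 3" x]
  obtain F where F: "finite F" "F \<subseteq> Ev" "dist (\<Sum>l\<in>F. P l x) x \<le> \<epsilon> / 3"
    by auto
  define z where "z = (\<Sum>l\<in>F. P l x)"
  \<comment> \<open>Inserting 0 keeps the maximum defined when \<open>F\<close> is empty.\<close>
  have "dist (PN N x) x < \<epsilon>" if N: "N \<ge> Max (insert 0 F)" for N
  proof -
    interpret bounded_linear "PN N" by (rule bounded_linear_PN)
    have "PN N (P l x) = P l x" if "l \<in> F" for l
    proof -
      have "l \<in> {0..N}"
        using that F N eigenvalue_nonneg by auto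
      then show ?thesis
        using that F fun_calc_eigenvector[OF P_mem, of l "indicator {0..N}" x] by (auto simp: spec_proj_def)
    qed
    then have "PN N z = z"
      by (simp add: z_def sum)
    then have eq: "PN N x - x = PN N (x - z) + (z - x)"
      by (simp add: diff)
    have "norm (PN N x - x) \<le> norm (x - z) + norm (z - x)"
      unfolding eq using norm_triangle_ineq[of "PN N (x - z)" "z - x"] norm_PN_le[of N "x - z"]
      by linarith
    also have "\<dots> < \<epsilon>"
      using F(3) \<open>\<epsilon> > 0\<close> by (simp add: dist_norm norm_minus_commute flip: z_def)
    finally show ?thesis by (simp add: dist_norm)
  qed
  then show "\<forall>\<^sub>F N in at_top. dist (PN N x) x < \<epsilon>"
    unfolding eventually_at_top_linorder by blast
qed

end

section \<open>Transport of the family to bounded operators\<close>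

locale bounded_family = positive_compact_resolvent D0 H0
  for D0 :: "'a::complex_hilbert set" and H0 +
  fixes H :: "real \<Rightarrow> 'a \<Rightarrow> 'a" and \<mu> :: real
  assumes mu: "\<mu> \<ge> 0"
    and H_bounded: "\<And>s t. s \<ge> 0 \<Longrightarrow> bounded_between D0 H0 (s + \<mu>) s (H t)"
    and H_continuous: "\<And>s t0. s \<ge> 0 \<Longrightarrow> t0 \<in> {0..1} \<Longrightarrow>
          ((\<lambda>t. opnorm_between D0 H0 (s + \<mu>) s (\<lambda>x. H t x - H t0 x)) \<longlongrightarrow> 0) (at t0 within {0..1})"
begin

text \<open>This is \<open>H t\<close>, as a map from level \<open>s + \<mu>\<close> to level
  \<open>s\<close>, conjugated to the Hilbert space by the isometries of the scale.\<close>

definition B :: "real \<Rightarrow> real \<Rightarrow> 'a \<Rightarrow> 'a" where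
  "B s t y = \<Lambda> s (H t (J (s + \<mu>) y))"

lemma J_B:
  assumes "s \<ge> 0"
  shows "J s (B s t y) = H t (J (s + \<mu>) y)"
  unfolding B_def using H_bounded[OF assms, of t] J_mem[of "s + \<mu>" y] assms mu
  by (intro J_Lam) (auto simp: bounded_between_def)

text \<open>Identities for \<open>B\<close> can be checked after applying \<open>J s\<close>, which
  avoids any linearity argument for the unbounded \<open>\<Lambda> s\<close>.\<close>

lemma B_unique: "s \<ge> 0 \<Longrightarrow> J s x = H t (J (s + \<mu>) y) \<Longrightarrow> B s t y = x"
  unfolding B_def by (metis Lam_J)

lemma bounded_linear_B:
  assumes s: "s \<ge> 0"
  shows "bounded_linear (B s t)"
proof -
  interpret J: bounded_linear "J s" by (rule bounded_linear_J[OF s])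
  interpret J': bounded_linear "J (s + \<mu>)" using s mu by (intro bounded_linear_J) simp
  have mem: "J (s + \<mu>) x \<in> Hs (s + \<mu>)" for x
    using s mu by (intro J_mem) simp
  obtain C where lin: "clinear_on (Hs (s + \<mu>)) (H t)"
    and C: "\<And>x. x \<in> Hs (s + \<mu>) \<Longrightarrow> Hnorm D0 H0 s (H t x) \<le> C * Hnorm D0 H0 (s + \<mu>) x"
    using H_bounded[OF s, of t] unfolding bounded_between_def by blast
  show ?thesis
  proof (rule bounded_linear_intro[where K = C])
    show "B s t (x + y) = B s t x + B s t y" for x y
      using lin mem[of x] mem[of y]
      by (intro B_unique[OF s]) (simp add: J.add J'.add J_B[OF s] clinear_on_def)
    have "H t (a *\<^sub>R J (s + \<mu>) x) = a *\<^sub>R H t (J (s + \<mu>) x)" for a x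
      using lin mem[of x] unfolding clinear_on_def scaleC_of_real[symmetric] by blast
    then show "B s t (a *\<^sub>R x) = a *\<^sub>R B s t x" for a x
      by (intro B_unique[OF s]) (simp add: J.scaleR J'.scaleR J_B[OF s])
    show "norm (B s t x) \<le> norm x * C" for x
      using C[OF mem[of x]] Hnorm_J[of "s + \<mu>" x] s mu
      by (simp add: B_def Hnorm_def[of _ _ s] mult.commute)
  qed
qed

text \<open>\<open>J (s + \<mu>)\<close> maps the unit ball onto the unit ball of the scale space,
  so \<open>opnorm_between\<close> is the ordinary operator norm of the difference of the
  \<open>B\<close>.\<close>

lemma norm_B_diff:
  assumes s: "s \<ge> 0"
  defines "g \<equiv> \<lambda>t t'. opnorm_between D0 H0 (s + \<mu>) s (\<lambda>x. H t x - H t' x)"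
  shows "norm (B s t y - B s t' y) \<le> g t t' * norm y" and "g t t = 0"
proof -
  have Hn: "Hnorm D0 H0 s (H t (J (s + \<mu>) z) - H t' (J (s + \<mu>) z)) = norm (B s t z - B s t' z)" for z t t'
  proof -
    interpret J: bounded_linear "J s" by (rule bounded_linear_J[OF s])
    show ?thesis
      using Hnorm_J[OF s, of "B s t z - B s t' z"] by (simp add: J.diff J_B[OF s])
  qed
  have smu: "s + \<mu> \<ge> 0" using s mu by simp
  have set_eq: "{x \<in> Hs (s + \<mu>). Hnorm D0 H0 (s + \<mu>) x \<le> 1} = J (s + \<mu>) ` {z. norm z \<le> 1}"
  proof safe
    fix x assume x: "x \<in> Hs (s + \<mu>)" "Hnorm D0 H0 (s + \<mu>) x \<le> 1"
    from x(1) obtain z where "x = J (s + \<mu>) z" by (rule J_cases)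
    with x(2) show "x \<in> J (s + \<mu>) ` {z. norm z \<le> 1}"
      using Hnorm_J[OF smu, of z] by auto
  qed (auto simp: J_mem smu Hnorm_J)
  have g: "g t t' = (SUP z\<in>{z. norm z \<le> 1}. norm (B s t z - B s t' z))" for t t'
    unfolding g_def opnorm_between_def set_eq image_image by (simp add: Hn)
  show "g t t = 0"
  proof -
    have "{z::'a. norm z \<le> 1} \<noteq> {}" by (auto intro: exI[of _ 0])
    then show ?thesis by (simp add: g)
  qed
  have bl: "bounded_linear (\<lambda>z. B s t z - B s t' z)"
    by (intro bounded_linear_sub bounded_linear_B s)
  then interpret bounded_linear "\<lambda>z. B s t z - B s t' z" .
  show "norm (B s t y - B s t' y) \<le> g t t' * norm y"
  proof (cases "y = 0")
    case False
    have "norm (B s t ((1 / norm y) *\<^sub>R y) - B s t' ((1 / norm y) *\<^sub>R y)) \<le> g t t'"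
      unfolding g
    proof (rule cSUP_upper)
      show "bdd_above ((\<lambda>z. norm (B s t z - B s t' z)) ` {z. norm z \<le> 1})"
      proof (rule bdd_aboveI2)
        fix z :: 'a assume "z \<in> {z. norm z \<le> 1}"
        then have "norm z \<le> 1" by simp
        from mult_left_mono[OF this onorm_pos_le[OF bl]] onorm[OF bl, of z]
        show "norm (B s t z - B s t' z) \<le> onorm (\<lambda>z. B s t z - B s t' z) * 1"
          by linarith
      qed
    qed (use False in simp)
    moreover have "B s t ((1 / norm y) *\<^sub>R y) - B s t' ((1 / norm y) *\<^sub>R y) = (1 / norm y) *\<^sub>R (B s t y - B s t' y)"
      by (rule scaleR)
    ultimately have "norm (B s t y - B s t' y) / norm y \<le> g t t'"
      by simp
    then show ?thesis
      using False by (simp add: pos_divide_le_eq)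
  qed (simp add: zero)
qed

lemma continuous_on_B:
  assumes s: "s \<ge> 0"
  shows "continuous_on ({0..1} \<times> UNIV) (\<lambda>(t, y). B s t y)"
  unfolding continuous_on_def
proof (rule ballI)
  fix p assume p: "p \<in> {0..1::real} \<times> (UNIV :: 'a set)"
  let ?F = "at p within {0..1} \<times> UNIV"
  let ?g = "\<lambda>t. opnorm_between D0 H0 (s + \<mu>) s (\<lambda>x. H t x - H (fst p) x)"
  interpret bounded_linear "B s (fst p)" by (rule bounded_linear_B[OF s])
  \<comment> \<open>The punctured limit in the hypothesis says nothing at \<open>fst p\<close>
    itself. The vanishing of the norm there upgrades it to continuity, as nearby pairs may share
    that first coordinate.\<close>
  have "continuous (at (fst p) within {0..1}) ?g"
    using H_continuous[OF s, of "fst p"] p norm_B_diff(2)[OF s, of "fst p"]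
    by (auto simp: continuous_within)
  moreover have "\<forall>\<^sub>F q in ?F. fst q \<in> {0..1}"
    unfolding eventually_at_filter by (rule always_eventually) auto
  ultimately have "((\<lambda>q. ?g (fst q)) \<longlongrightarrow> ?g (fst p)) ?F"
    by (rule continuous_within_tendsto_compose) (intro tendsto_intros)
  then have "((\<lambda>q. ?g (fst q) * norm (snd q) + norm (B s (fst p) (snd q - snd p))) \<longlongrightarrow>
      ?g (fst p) * norm (snd p) + norm (B s (fst p) (snd p - snd p))) ?F"
    by (intro tendsto_intros tendsto)
  then have "((\<lambda>q. ?g (fst q) * norm (snd q) + norm (B s (fst p) (snd q - snd p))) \<longlongrightarrow> 0) ?F"
    unfolding norm_B_diff(2)[OF s] by (simp add: zero)
  then have "((\<lambda>q. B s (fst q) (snd q) - B s (fst p) (snd p)) \<longlongrightarrow> 0) ?F"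
  proof (rule Lim_null_comparison[rotated], intro always_eventually allI)
    fix q
    have eq: "B s (fst q) (snd q) - B s (fst p) (snd p) =
        (B s (fst q) (snd q) - B s (fst p) (snd q)) + B s (fst p) (snd q - snd p)"
      by (simp add: diff)
    show "norm (B s (fst q) (snd q) - B s (fst p) (snd p)) \<le>
        ?g (fst q) * norm (snd q) + norm (B s (fst p) (snd q - snd p))"
      unfolding eq using norm_B_diff(1)[OF s, of "fst q" "snd q" "fst p"]
        norm_triangle_ineq[of "B s (fst q) (snd q) - B s (fst p) (snd q)" "B s (fst p) (snd q - snd p)"]
      by linarith
  qed
  then show "((\<lambda>(t, y). B s t y) \<longlongrightarrow> (case p of (t, y) \<Rightarrow> B s t y)) ?F"
    by (simp add: case_prod_unfold LIM_zero_iff)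
qed

text \<open>Each \<open>Q e\<close> commutes with \<open>J\<close>, so compressing
  \<open>H t\<close> by \<open>Q e\<close> compresses \<open>B\<close> in the same way. This treats
  truncations and the identity as members of one family.\<close>

lemma FM_eff_compressed:
  fixes Q :: "'p::topological_space \<Rightarrow> 'a \<Rightarrow> 'a"
  assumes lin: "\<And>e. e \<in> U \<Longrightarrow> bounded_linear (Q e)" and contr: "\<And>e x. e \<in> U \<Longrightarrow> norm (Q e x) \<le> norm x"
    and cont: "\<And>x. continuous_on U (\<lambda>e. Q e x)"
    and QJ: "\<And>e s x. e \<in> U \<Longrightarrow> s \<ge> 0 \<Longrightarrow> Q e (J s x) = J s (Q e x)"
    and r: "r \<ge> 0" and u: "u \<in> Hs (r + real (L + 1) * \<mu>)"
  shows "lifts (J r) U (\<lambda>e. FM_eff T L (\<lambda>t. Q e \<circ> H t \<circ> Q e) (Q e u))"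
proof -
  note Q_cont = continuous_on_contractions[OF lin contr cont]
  interpret scale_family J \<mu> U "\<lambda>e t. Q e \<circ> H t \<circ> Q e" "\<lambda>s e t y. Q e (B s t (Q e y))"
  proof (rule scale_family.intro)
    show "0 \<le> \<mu>" by (rule mu)
    show "bounded_linear (J s)" if "s \<ge> 0" for s by (rule bounded_linear_J[OF that])
    show "J s (c *\<^sub>C x) = c *\<^sub>C J s x" if "s \<ge> 0" for s c x by (rule J_scaleC[OF that])
    show "(Q e \<circ> H t \<circ> Q e) (J (s + \<mu>) y) = J s (Q e (B s t (Q e y)))"
      if s: "s \<ge> 0" and e: "e \<in> U" for s e t y
    proof -
      have "s + \<mu> \<ge> 0" using s mu by simp
      then show ?thesis
        by (simp only: o_apply QJ[OF e] J_B[OF s, symmetric] QJ[OF e s])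
    qed
    show "bounded_linear (\<lambda>y. Q e (B s t (Q e y)))" if "s \<ge> 0" "e \<in> U" for s e t
      using bounded_linear_compose[OF lin[OF that(2)]
          bounded_linear_compose[OF bounded_linear_B[OF that(1), of t] lin[OF that(2)]]] .
  next
    fix s :: real assume s: "s \<ge> 0"
    let ?V = "U \<times> {0..1::real} \<times> (UNIV :: 'a set)"
    have "continuous_on ?V (\<lambda>q. Q (fst q) (snd (snd q)))"
      by (rule continuous_on_compose2[OF Q_cont, of _ "\<lambda>q. (fst q, snd (snd q))",
            unfolded case_prod_conv])
         (auto intro!: continuous_intros)
    then have "continuous_on ?V (\<lambda>q. B s (fst (snd q)) (Q (fst q) (snd (snd q))))"
      by (intro continuous_on_compose2[OF continuous_on_B[OF s], of _
            "\<lambda>q. (fst (snd q), Q (fst q) (snd (snd q)))", unfolded case_prod_conv])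
         (auto intro!: continuous_intros)
    then have "continuous_on ?V (\<lambda>q. Q (fst q) (B s (fst (snd q)) (Q (fst q) (snd (snd q)))))"
      by (intro continuous_on_compose2[OF Q_cont, of _
            "\<lambda>q. (fst q, B s (fst (snd q)) (Q (fst q) (snd (snd q))))", unfolded case_prod_conv])
         (auto intro!: continuous_intros)
    then show "continuous_on ?V (\<lambda>(e, t, y). Q e (B s t (Q e y)))"
      by (simp add: case_prod_beta)
  qed
  show ?thesis
  proof (rule lifts_FM_eff[OF r])
    fix l assume l: "l \<le> L"
    \<comment> \<open>The term of order \<open>l\<close> needs only level \<open>a\<close>; the
      surplus regularity \<open>b\<close> of \<open>u\<close> is absorbed into the vector
      \<open>J b y\<close>.\<close>
    define a b where "a = r + real (l + 1) * \<mu>" and "b = real (L - l) * \<mu>"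
    have ab: "a \<ge> 0" "b \<ge> 0"
      using r mu by (auto simp: a_def b_def)
    have "real (L + 1) = real (l + 1) + real (L - l)"
      using l by simp
    then have "r + real (L + 1) * \<mu> = a + b"
      by (simp only: a_def b_def distrib_right add.assoc)
    with u have "u \<in> Hs (a + b)" by simp
    then obtain y where y: "u = J (a + b) y"
      by (rule J_cases)
    have "lifts (J a) U (\<lambda>e. Q e u)"
    proof (rule liftsI)
      show "continuous_on U (\<lambda>e. Q e (J b y))" by (rule cont)
      show "Q e u = J a (Q e (J b y))" if "e \<in> U" for e
        by (simp only: y J_add[OF ab] QJ[OF that ab(1)])
    qed
    then show "lifts (J (r + real (l + 1) * \<mu>)) U (\<lambda>e. Q e u)"
      by (simp only: a_def)
  qed
qed

end

section \<open>Convergence of the truncated effective Hamiltonians\<close>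

theorem corollary4p5:
  fixes D0 :: "'a::complex_hilbert set" and H0 :: "'a \<Rightarrow> 'a"
    and D :: "real \<Rightarrow> 'a set" and H :: "real \<Rightarrow> 'a \<Rightarrow> 'a"
    and \<mu> r T :: real and L :: nat and u :: 'a
  assumes separable: "separable_space (euclidean :: 'a topology)"
    and H0: "positive_self_adjoint D0 H0" "compact_resolvent D0 H0"
    and mu: "\<mu> \<ge> 0"
    and symmetric: "\<And>t. symmetric_op (D t) (H t)"
    and periodic: "\<And>t. D (t + 1) = D t" "\<And>t x. x \<in> D t \<Longrightarrow> H (t + 1) x = H t x"
    and domain: "\<And>s t. s \<ge> 0 \<Longrightarrow> Hscale D0 H0 (s + \<mu>) \<subseteq> D t"
    and bounded: "\<And>s t. s \<ge> 0 \<Longrightarrow> bounded_between D0 H0 (s + \<mu>) s (H t)"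
    and continuous: "\<And>s t0. s \<ge> 0 \<Longrightarrow> t0 \<in> {0..1} \<Longrightarrow>
          ((\<lambda>t. opnorm_between D0 H0 (s + \<mu>) s (\<lambda>x. H t x - H t0 x)) \<longlongrightarrow> 0) (at t0 within {0..1})"
    and r: "r \<ge> 0"
    and u: "u \<in> Hscale D0 H0 (r + real (L + 1) * \<mu>)"
    and T: "T > 0"
  shows "FM_eff T L H u \<in> Hscale D0 H0 r \<and>
         (\<forall>N>0. FM_eff T L (truncated D0 H0 N H) (spec_proj D0 H0 N u) \<in> Hscale D0 H0 r) \<and>
         ((\<lambda>N. Hnorm D0 H0 r
             (FM_eff T L (truncated D0 H0 N H) (spec_proj D0 H0 N u) - FM_eff T L H u)) \<longlongrightarrow> 0) at_top"
proof -
  interpret bounded_family D0 H0 H \<mu>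
    by unfold_locales (use H0 mu bounded continuous in auto)
  interpret J: bounded_linear "J r" by (rule bounded_linear_J[OF r])
  define W where "W Q = FM_eff T L (\<lambda>t. Q \<circ> H t \<circ> Q) (Q u)" for Q
  have W_id: "W (\<lambda>x. x) = FM_eff T L H u"
    by (simp add: W_def o_def)
  have W_PN: "W (PN N) = FM_eff T L (truncated D0 H0 N H) (PN N u)" for N
    by (simp add: W_def truncated_def[abs_def])
  have W_mem: "W Q \<in> Hs r"
    if "bounded_linear Q" "\<And>x. norm (Q x) \<le> norm x" "\<And>s x. s \<ge> 0 \<Longrightarrow> Q (J s x) = J s (Q x)" for Q
  proof -
    \<comment> \<open>Over a one-point parameter set, continuity is trivial and a lift only
      expresses membership in the scale space.\<close>
    have "lifts (J r) {0::real} (\<lambda>_. W Q)"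
      unfolding W_def using that by (intro FM_eff_compressed r u) auto
    then show ?thesis
      by (auto simp: lifts_def J_mem r)
  qed
  have "((\<lambda>N. Hnorm D0 H0 r (W (PN N) - W (\<lambda>x. x))) \<longlongrightarrow> 0) at_top"
  proof (rule tendsto_at_topI_sequentially)
    fix X :: "nat \<Rightarrow> real" assume X: "filterlim X at_top sequentially"
    \<comment> \<open>The parameter space \<^typ>\<open>enat\<close> turns convergence along \<open>X\<close> into continuity at \<open>\<infinity>\<close>.\<close>
    define Q where "Q e = (case e of enat n \<Rightarrow> PN (X n) | \<infinity> \<Rightarrow> \<lambda>x. x)" for e
    have "lifts (J r) UNIV (\<lambda>e. W (Q e))"
      unfolding W_def
    proof (rule FM_eff_compressed[OF _ _ _ _ r u])
      show "continuous_on UNIV (\<lambda>e. Q e x)" for x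
        using filterlim_compose[OF tendsto_PN X] by (simp add: continuous_on_UNIV_enat_iff Q_def)
    qed (auto simp: Q_def bounded_linear_PN norm_PN_le PN_J split: enat.split)
    then obtain z where z: "continuous_on UNIV z" "\<And>e. W (Q e) = J r (z e)"
      unfolding lifts_def by blast
    \<comment> \<open>\<open>J r\<close> is an isometry, so continuity of the lift \<open>z\<close>
      at \<infinity> is exactly convergence in the norm of order \<open>r\<close>.\<close>
    have "Hnorm D0 H0 r (W (PN (X n)) - W (\<lambda>x. x)) = norm (z (enat n) - z \<infinity>)" for n
      using z(2)[of "enat n"] z(2)[of \<infinity>] Hnorm_J[OF r, of "z (enat n) - z \<infinity>"]
      by (simp add: Q_def J.diff)
    moreover have "(\<lambda>n. norm (z (enat n) - z \<infinity>)) \<longlonglongrightarrow> 0"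
      using z(1) by (intro tendsto_norm_zero) (simp add: continuous_on_UNIV_enat_iff LIM_zero_iff)
    ultimately show "(\<lambda>n. Hnorm D0 H0 r (W (PN (X n)) - W (\<lambda>x. x))) \<longlonglongrightarrow> 0"
      by simp
  qed
  moreover have "W (\<lambda>x. x) \<in> Hs r"
    by (rule W_mem) auto
  moreover have "W (PN N) \<in> Hs r" for N
    by (rule W_mem) (auto simp: bounded_linear_PN norm_PN_le PN_J)
  ultimately show ?thesis
    by (simp add: W_id W_PN)
qed

end
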